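(* For every integer $n\geq 1$, the cover graph $G(L(Q_n))$ of the face lattice of the $n$-dimensional hypercube $Q_n$ has a rhombic strip.
   Context: $Q_n$ is the convex hull of $\{0,1\}^n$. For a polytope $P$, $L(P)$ is the set of all faces of $P$ (including $\emptyset$ and $P$) ordered by inclusion; it is graded with rank function given by dimension ($\dim\emptyset=-1$). Its cover graph $G(L(P))$ has an edge between faces $F\subset F'$ with $\dim F'=\dim F+1$. The cylinder is the quotient of $\mathbb{R}^2$ by $(x,y)\sim(x+1,y)$. For a graded poset with rank function $\rho$, a rhombic strip is a spanning subgraph of its cover graph embedded on the cylinder such that: each vertex $x$ is placed at height $\rho(x)$; edges are drawn as straight line segments without crossings; and every face of the embedding is a rhombus, i.e., a $4$-cycle $(a,b,c,d)$ with $\rho(a)=\rho(c)=r$, $\rho(b)=r-1$, $\rho(d)=r+1$ for some $r$. *)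

theory Defs
  imports "HOL-Analysis.Analysis"
begin

section \<open>The cylinder\<close>

text \<open>
  The cylinder \<open>\<real>\<^sup>2 / ((x, y) \<sim> (x + 1, y))\<close> is modelled concretely as the product of the unit
  circle with the real line; \<open>cyl_proj\<close> is the quotient projection, and the second component is
  the height. The lemmas below show that \<open>cyl_proj\<close> is a quotient map whose fibres are exactly
  the classes of this relation.
\<close>

definition cylinder :: "(complex \<times> real) set" where
  "cylinder = sphere 0 1 \<times> UNIV"

definition cyl_proj :: "real \<times> real \<Rightarrow> complex \<times> real" where
  "cyl_proj p = (cis (2 * pi * fst p), snd p)"

lemma cyl_proj_eq_iff:
  "cyl_proj p = cyl_proj q \<longleftrightarrow> snd p = snd q \<and> (\<exists>k::int. fst p = fst q + of_int k)"
proof -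
  have "cis (2 * pi * fst p) = cis (2 * pi * fst q) \<longleftrightarrow> (\<exists>k::int. fst p = fst q + of_int k)"
  proof -
    have "cis (2 * pi * fst p) = cis (2 * pi * fst q) \<longleftrightarrow>
        (\<exists>n::int. \<i> * complex_of_real (2 * pi * fst p) =
                \<i> * complex_of_real (2 * pi * fst q) + of_int (2 * n) * complex_of_real pi * \<i>)"
      unfolding cis_conv_exp by (simp add: exp_eq)
    also have "\<dots> \<longleftrightarrow> (\<exists>n::int. fst p = fst q + of_int n)"
    proof (intro ex_cong1)
      fix n :: int
      have "\<i> * complex_of_real (2 * pi * fst p) =
          \<i> * complex_of_real (2 * pi * fst q) + of_int (2 * n) * complex_of_real pi * \<i>
        \<longleftrightarrow> 2 * pi * fst p = 2 * pi * (fst q + of_int n)"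
        by (simp add: complex_eq_iff algebra_simps)
      also have "\<dots> \<longleftrightarrow> fst p = fst q + of_int n"
        by simp
      finally show "\<i> * complex_of_real (2 * pi * fst p) =
          \<i> * complex_of_real (2 * pi * fst q) + of_int (2 * n) * complex_of_real pi * \<i>
        \<longleftrightarrow> fst p = fst q + of_int n" .
    qed
    finally show ?thesis .
  qed
  then show ?thesis
    by (auto simp: cyl_proj_def)
qed

lemma cyl_proj_image: "range cyl_proj = cylinder"
proof
  show "range cyl_proj \<subseteq> cylinder"
    by (auto simp: cyl_proj_def cylinder_def)
  show "cylinder \<subseteq> range cyl_proj"
  proof
    fix z assume "z \<in> cylinder"
    then have n: "norm (fst z) = 1" by (auto simp: cylinder_def)
    have "cis (Arg (fst z)) = fst z"
      using n cis_Arg[of "fst z"] by (cases "fst z = 0") (auto simp: sgn_div_norm)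
    then have "cyl_proj (Arg (fst z) / (2 * pi), snd z) = z"
      by (simp add: cyl_proj_def)
    then show "z \<in> range cyl_proj" by (metis rangeI)
  qed
qed

lemma continuous_on_cyl_proj: "continuous_on A cyl_proj"
  unfolding cyl_proj_def by (intro continuous_intros)

lemma quotient_map_cyl_proj: "quotient_map euclidean (top_of_set cylinder) cyl_proj"
proof -
  have "openin (top_of_set cylinder) U"
    if U: "U \<subseteq> cylinder" and op: "open (cyl_proj -` U)" for U
  proof -
    define W where "W = exp ` ((\<lambda>z. (Im z / (2 * pi), Re z)) -` (cyl_proj -` U))"
    have "open ((\<lambda>z::complex. (Im z / (2 * pi), Re z)) -` (cyl_proj -` U))"
      by (rule open_vimage[OF op]) (intro continuous_intros, auto)
    then have "openin (top_of_set UNIV)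
        ((\<lambda>z::complex. (Im z / (2 * pi), Re z)) -` (cyl_proj -` U))"
      by (simp only: subtopology_UNIV open_openin)
    then have "openin (top_of_set (- {0})) W"
      unfolding W_def by (rule covering_space_open_map[OF covering_space_exp_punctured_plane])
    then have oW: "open W"
      using openin_open_eq[OF open_Compl[OF closed_singleton]] by blast
    have polar: "exp (complex_of_real y) * cis t = exp (Complex y t)" for y t
      by (simp add: cis_conv_exp Complex_eq exp_add exp_of_real mult.commute)
    have "U = cylinder \<inter> (\<lambda>z. exp (complex_of_real (snd z)) * fst z) -` W"
    proof (intro set_eqI iffI)
      fix z assume z: "z \<in> U"
      then obtain p where p: "z = cyl_proj p"
        using U cyl_proj_image by blast
      have "exp (complex_of_real (snd z)) * fst z = exp (Complex (snd p) (2 * pi * fst p))"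
        by (simp add: p cyl_proj_def polar)
      moreover have "Complex (snd p) (2 * pi * fst p)
          \<in> (\<lambda>z. (Im z / (2 * pi), Re z)) -` (cyl_proj -` U)"
        using z p by simp
      ultimately have "exp (complex_of_real (snd z)) * fst z \<in> W"
        unfolding W_def by (rule image_eqI)
      then show "z \<in> cylinder \<inter> (\<lambda>z. exp (complex_of_real (snd z)) * fst z) -` W"
        using U z by auto
    next
      fix z assume z: "z \<in> cylinder \<inter> (\<lambda>z. exp (complex_of_real (snd z)) * fst z) -` W"
      then obtain w where w: "cyl_proj (Im w / (2 * pi), Re w) \<in> U"
          and e: "exp (complex_of_real (snd z)) * fst z = exp w"
        unfolding W_def by blast
      have n: "norm (fst z) = 1" using z by (auto simp: cylinder_def)
      have "norm (exp (complex_of_real (snd z)) * fst z) = norm (exp w)"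
        using e by simp
      then have s: "snd z = Re w"
        using n by (simp add: norm_mult)
      have "exp w = exp (complex_of_real (Re w)) * cis (Im w)"
        by (simp add: polar)
      then have "fst z = cis (Im w)"
        using e s by simp
      then have "z = cyl_proj (Im w / (2 * pi), Re w)"
        using s by (simp add: cyl_proj_def prod_eq_iff)
      then show "z \<in> U" using w by simp
    qed
    moreover have "open ((\<lambda>z. exp (complex_of_real (snd z)) * fst z) -` W)"
      by (rule open_vimage[OF oW]) (intro continuous_intros)
    ultimately show ?thesis
      unfolding openin_open by blast
  qed
  moreover have "open (cyl_proj -` U)" if "openin (top_of_set cylinder) U" for U
  proof -
    have "openin (top_of_set UNIV) (UNIV \<inter> cyl_proj -` U)"
      by (rule continuous_openin_preimage[OF continuous_on_cyl_proj _ that])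
         (use cyl_proj_image in auto)
    then show ?thesis
      by (simp only: subtopology_UNIV open_openin Int_UNIV_left)
  qed
  ultimately have "\<forall>U. U \<subseteq> cylinder \<longrightarrow>
      (open (cyl_proj -` U) \<longleftrightarrow> openin (top_of_set cylinder) U)"
    by blast
  then show ?thesis
    by (simp add: quotient_map_def cyl_proj_image vimage_def)
qed


section \<open>Rhombic strips\<close>

text \<open>
  For a set \<open>V\<close> graded by \<open>\<rho>\<close>, the cover relations are the pairs \<open>x < y\<close> of elements of
  consecutive rank. Edges are stored as pairs oriented upwards.
\<close>

definition cover_graph :: "'v::order set \<Rightarrow> ('v \<Rightarrow> int) \<Rightarrow> ('v \<times> 'v) set" where
  "cover_graph V \<rho> = {(x, y). x \<in> V \<and> y \<in> V \<and> x < y \<and> \<rho> y = \<rho> x + 1}"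

text \<open>
  A drawing assigns to each vertex \<open>x\<close> a point \<open>pos x\<close> and to each edge \<open>e\<close> a point set
  \<open>seg e\<close>. A straight line segment on the cylinder is the projection of a segment of the plane;
  it may wind around the cylinder. Since edges join different heights, such a projection is
  injective, so no edge crosses itself.
\<close>

definition straight_cylinder_embedding ::
  "'v set \<Rightarrow> ('v \<times> 'v) set \<Rightarrow> ('v \<Rightarrow> int) \<Rightarrow> ('v \<Rightarrow> complex \<times> real) \<Rightarrow>
   ('v \<times> 'v \<Rightarrow> (complex \<times> real) set) \<Rightarrow> bool" where
  "straight_cylinder_embedding V E \<rho> pos seg \<longleftrightarrow>
     inj_on pos V \<and>
     (\<forall>x\<in>V. pos x \<in> cylinder \<and> snd (pos x) = of_int (\<rho> x)) \<and>
     (\<forall>(x, y)\<in>E. \<exists>p q. cyl_proj p = pos x \<and> cyl_proj q = pos y \<and>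
                    seg (x, y) = cyl_proj ` closed_segment p q) \<and>
     (\<forall>(x, y)\<in>E. \<forall>v\<in>V. pos v \<in> seg (x, y) \<longrightarrow> v = x \<or> v = y) \<and>
     (\<forall>(x, y)\<in>E. \<forall>(x', y')\<in>E. (x, y) \<noteq> (x', y') \<longrightarrow>
        seg (x, y) \<inter> seg (x', y') \<subseteq> pos ` ({x, y} \<inter> {x', y'}))"

definition drawing_faces ::
  "'v set \<Rightarrow> ('v \<times> 'v) set \<Rightarrow> ('v \<Rightarrow> complex \<times> real) \<Rightarrow>
   ('v \<times> 'v \<Rightarrow> (complex \<times> real) set) \<Rightarrow> (complex \<times> real) set set" where
  "drawing_faces V E pos seg = components (cylinder - (pos ` V \<union> \<Union> (seg ` E)))"

text \<open>
  A face is a rhombus if its boundary is the closed curve formed by the edges of a 4-cycle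
  \<open>(a, b, c, d)\<close>; distinctness of the vertices other than \<open>a\<close> and \<open>c\<close> follows from the ranks.
\<close>

definition is_rhombus ::
  "('v \<times> 'v) set \<Rightarrow> ('v \<Rightarrow> int) \<Rightarrow> ('v \<times> 'v \<Rightarrow> (complex \<times> real) set) \<Rightarrow>
   (complex \<times> real) set \<Rightarrow> bool" where
  "is_rhombus E \<rho> seg C \<longleftrightarrow>
     (\<exists>a b c d r. a \<noteq> c \<and> {(b, a), (b, c), (a, d), (c, d)} \<subseteq> E \<and>
        \<rho> a = r \<and> \<rho> c = r \<and> \<rho> b = r - 1 \<and> \<rho> d = r + 1 \<and>
        (top_of_set cylinder) frontier_of C = seg (b, a) \<union> seg (b, c) \<union> seg (a, d) \<union> seg (c, d))"

text \<open>
  The faces are the components of the complement of the drawing, including the unbounded ones,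
  so the 4-cycle bounding a face may wind around the cylinder.
\<close>

definition has_rhombic_strip :: "'v::order set \<Rightarrow> ('v \<Rightarrow> int) \<Rightarrow> bool" where
  "has_rhombic_strip V \<rho> \<longleftrightarrow>
     (\<exists>E pos seg. E \<subseteq> cover_graph V \<rho> \<and> straight_cylinder_embedding V E \<rho> pos seg \<and>
        (\<forall>C \<in> drawing_faces V E pos seg. is_rhombus E \<rho> seg C))"


section \<open>The face lattice of the hypercube\<close>

definition hypercube :: "(real ^ 'n) set" where
  "hypercube = convex hull {x. \<forall>i. x $ i = 0 \<or> x $ i = 1}"

text \<open>Ordered by inclusion; the empty face and \<open>P\<close> itself are included.\<close>

definition face_lattice :: "'a::real_vector set \<Rightarrow> 'a set set" where
  "face_lattice P = {F. F face_of P}"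

end

theory Submission
  imports Defs
begin

text \<open>
  A rhombic strip amounts to a cyclic sequence of complete flags (a vertex, an edge containing it,
  and so on), consecutive ones differing in a single face, in which every proper face is entered
  exactly once per turn. The flags are the monotone paths that sweep around the cylinder: put each
  face at the time of its entry. Positions on a level increase with time, so straight edges do not
  cross, and the region between two successive paths is the rhombus of the flip between them.

  For the cube the sequence is built by induction on the dimension. It is carried along with a wire:
  a position \<open>p\<close> in the flag \<open>F\<^sub>0 < \<dots> < F\<^sub>n\<close>, moving by single steps, that
  never sits on the level being flipped and visits every face exactly once. A wire turns a flag into
  the flag \<open>F\<^sub>0 \<times> e < \<dots> < F\<^sub>p \<times> e < F\<^sub>p \<times> [0,1] < \<dots> < F\<^sub>n \<times> [0,1]\<close>
  of the next cube. Following the walk with \<open>e = 0\<close> enters every \<open>F \<times> 0\<close> and every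
  \<open>F \<times> [0,1]\<close> once; switching to \<open>e = 1\<close>, pushing the wire to the top and walking
  back enters every \<open>F \<times> 1\<close>. The new wire crosses the old one once in every face that the old
  one visits, and retraces it on the way back.
\<close>

section \<open>Drawing a sweep on the cylinder\<close>

text \<open>Both conditions on the wire come from the lifted flag. The face that holds the wire
  occurs in it twice, as \<open>F\<^sub>p \<times> e\<close> and as
  \<open>F\<^sub>p \<times> [0,1]\<close>; flipping it would change two levels at once, so flips
  have to avoid it. The times at which \<open>F \<times> 0\<close> and
  \<open>F \<times> [0,1]\<close> are present cover the single visit of \<open>F\<close> and overlap
  exactly while the wire sits in \<open>F\<close>. By inclusion-exclusion, a single visit of the
  wire is what makes each of the two a single run. The ends of the walk matter as well. With the
  wire at level 0, the change from \<open>e = 0\<close> to \<open>e = 1\<close> flips the bottom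
  level alone. With the wire at the top all the way back, the last flag consists, below the cube
  itself, of the first flag of the old walk times 1. Each of its faces then lies in the next face of
  the first new flag, so the cycle can be closed by exchanging the levels one by one from above. The
  drawing needs one more fact, that no edge is seen with two different windings. It rests on the
  observation that a nonempty proper face is never contained in all faces of the next dimension,
  unless these are the whole cube.\<close>

lemma connected_cyl_region:
  fixes a b :: "real \<Rightarrow> real"
  assumes "continuous_on UNIV a" "continuous_on UNIV b" "connected {h. a h < b h}"
    and Z: "Z \<subseteq> {h. a h < b h}"
  shows "connected (cyl_proj ` ({(x, h). a h < x \<and> x < b h} \<union> UNIV \<times> Z))"
proof -
  let ?I = "{h. a h < b h}" and ?R = "{(x, h). a h < x \<and> x < b h}"
  have "?R = (\<lambda>(h, t). (a h + t * (b h - a h), h)) ` (?I \<times> {0<..<1})" (is "_ = ?f ` _")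
  proof (intro set_eqI iffI)
    fix z assume "z \<in> ?R"
    then obtain x h where z: "z = (x, h)" and xh: "a h < x" "x < b h" by auto
    then have "z = ?f (h, (x - a h) / (b h - a h))" and "(x - a h) / (b h - a h) \<in> {0<..<1}"
      using z xh by (simp_all add: divide_simps)
    then show "z \<in> ?f ` (?I \<times> {0<..<1})" using xh by (intro image_eqI[of _ _ "(h, (x - a h) / (b h - a h))"]) auto
  next
    fix z assume "z \<in> ?f ` (?I \<times> {0<..<1})"
    then obtain h t where z: "z = (a h + t * (b h - a h), h)" and h: "a h < b h" and t: "0 < t" "t < 1" by auto
    have "0 < t * (b h - a h)" using h t by simp
    moreover have "t * (b h - a h) < 1 * (b h - a h)" using h t by (intro mult_strict_right_mono) auto
    ultimately show "z \<in> ?R" using z by auto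
  qed
  moreover have "connected (?f ` (?I \<times> {0<..<1}))"
  proof (rule connected_continuous_image)
    have "continuous_on (?I \<times> {0<..<1}) (\<lambda>z. a (fst z))" "continuous_on (?I \<times> {0<..<1}) (\<lambda>z. b (fst z))"
      by (rule continuous_on_compose2[OF assms(1)], auto intro: continuous_intros,
          rule continuous_on_compose2[OF assms(2)], auto intro: continuous_intros)
    then show "continuous_on (?I \<times> {0<..<1}) ?f"
      unfolding case_prod_beta by (intro continuous_intros)
    show "connected (?I \<times> {0<..<1::real})"
      using assms(3) by (intro connected_Times) auto
  qed
  ultimately have cR: "connected (cyl_proj ` ?R)"
    by (intro connected_continuous_image[OF continuous_on_cyl_proj]) simp
  \<comment> \<open>A full circle at a height in \<open>Z\<close> is connected and meets the open
    strip, since \<open>a h < b h\<close> there.\<close>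
  have "connected (cyl_proj ` ?R \<union> \<Union> ((\<lambda>h. cyl_proj ` (UNIV \<times> {h})) ` Z))"
  proof (rule connected_Un_UN[OF cR])
    fix X assume "X \<in> (\<lambda>h. cyl_proj ` (UNIV \<times> {h})) ` Z"
    then obtain h where h: "h \<in> Z" and X: "X = cyl_proj ` (UNIV \<times> {h})" by auto
    show "connected X"
      unfolding X by (rule connected_continuous_image[OF continuous_on_cyl_proj]) (simp add: connected_Times)
    have "((a h + b h) / 2, h) \<in> ?R" using h Z by auto
    then show "cyl_proj ` ?R \<inter> X \<noteq> {}" unfolding X by blast
  qed
  moreover have "cyl_proj ` ?R \<union> \<Union> ((\<lambda>h. cyl_proj ` (UNIV \<times> {h})) ` Z) = cyl_proj ` (?R \<union> UNIV \<times> Z)"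
    by auto
  ultimately show ?thesis by simp
qed

lemma cyl_proj_preimage_image:
  "cyl_proj -` (cyl_proj ` S) = {(x, h). \<exists>k::int. (x + of_int k, h) \<in> S}"
proof (intro set_eqI iffI)
  fix z assume "z \<in> cyl_proj -` (cyl_proj ` S)"
  then obtain q where "q \<in> S" "cyl_proj q = cyl_proj z" by auto
  then obtain k :: int where "fst q = fst z + of_int k" "snd q = snd z" "q \<in> S" unfolding cyl_proj_eq_iff by auto
  then show "z \<in> {(x, h). \<exists>k::int. (x + of_int k, h) \<in> S}"
    by (cases z, cases q) auto
next
  fix z assume "z \<in> {(x, h). \<exists>k::int. (x + of_int k, h) \<in> S}"
  then obtain x h and k :: int where "z = (x, h)" "(x + of_int k, h) \<in> S" by auto
  moreover have "cyl_proj (x, h) = cyl_proj (x + of_int k, h)"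
    unfolding cyl_proj_eq_iff by (auto intro: exI[of _ "- k"])
  ultimately show "z \<in> cyl_proj -` (cyl_proj ` S)" by auto
qed

lemma openin_cyl_proj_image:
  assumes "open S" shows "openin (top_of_set cylinder) (cyl_proj ` S)"
proof -
  have "cyl_proj -` (cyl_proj ` S) = (\<Union>k::int. (\<lambda>z. z + (of_int k, 0)) -` S)"
    unfolding cyl_proj_preimage_image by (auto simp: plus_prod_def)
  moreover have "open ((\<lambda>z. z + (of_int k, 0)) -` S)" for k :: int
    by (intro open_vimage assms continuous_intros)
  ultimately have "open (cyl_proj -` (cyl_proj ` S))" by auto
  moreover have "cyl_proj ` S \<subseteq> cylinder" using cyl_proj_image by auto
  ultimately show ?thesis
    using quotient_map_cyl_proj unfolding quotient_map_def by (simp add: vimage_def)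
qed

lemma closedin_cyl_proj_image:
  assumes "closed (cyl_proj -` (cyl_proj ` S))"
  shows "closedin (top_of_set cylinder) (cyl_proj ` S)"
proof -
  have "cyl_proj ` S \<subseteq> cylinder" using cyl_proj_image by auto
  then show ?thesis
    using assms quotient_map_cyl_proj unfolding quotient_map_closedin by (simp add: vimage_def)
qed

text \<open>Since \<open>b h \<le> a h + 1\<close>, no translate of the open strip contains a point
  of a boundary curve. The circles over \<open>Z\<close> close the strip up where it is a whole turn
  wide: there both boundary curves project to the same points, which become interior.\<close>

lemma frontier_of_cyl_region:
  fixes a b :: "real \<Rightarrow> real"
  assumes ca: "continuous_on UNIV a" and cb: "continuous_on UNIV b"
    and ab: "\<And>h. a h \<le> b h" "\<And>h. b h \<le> a h + 1"
    and Z: "Z \<subseteq> {h. a h < b h}" and oZ: "open Z" and bZ: "\<And>h. h \<in> Z \<Longrightarrow> b h = a h + 1"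
  shows "(top_of_set cylinder) frontier_of (cyl_proj ` ({(x, h). a h < x \<and> x < b h} \<union> UNIV \<times> Z))
    = cyl_proj ` {(x, h). h \<in> closure {h. a h < b h} - Z \<and> (x = a h \<or> x = b h)}"
    (is "_ frontier_of ?C = cyl_proj ` ?F")
proof -
  let ?I = "{h. a h < b h}" and ?R = "{(x, h). a h < x \<and> x < b h}"
  have ca': "continuous_on UNIV (\<lambda>z::real \<times> real. a (snd z))"
   and cb': "continuous_on UNIV (\<lambda>z::real \<times> real. b (snd z))"
    by (rule continuous_on_compose2[OF ca], auto intro: continuous_intros,
        rule continuous_on_compose2[OF cb], auto intro: continuous_intros)
  have lift: "cyl_proj (x + of_int k, h) = cyl_proj (x, h)" for x h and k :: int
    unfolding cyl_proj_eq_iff by auto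
  have oR: "open ?R"
  proof -
    have "?R = {z. a (snd z) < fst z} \<inter> {z. fst z < b (snd z)}" by auto
    then show ?thesis
      by (auto intro!: open_Int open_Collect_less ca' cb' continuous_intros)
  qed
  then have oC: "openin (top_of_set cylinder) ?C"
    by (intro openin_cyl_proj_image open_Un open_Times oZ) auto
  define K where "K = {(x, h). h \<in> closure ?I \<and> a h \<le> x \<and> x \<le> b h}"
  have "closed (cyl_proj -` (cyl_proj ` K))"
  proof -
    \<comment> \<open>An infinite union of closed translates need not be closed, so the preimage is
      described by its complement over \<open>closure ?I\<close>: the open gaps between consecutive
      translates of the closed strip.\<close>
    let ?O = "\<Union>k::int. {z. b (snd z) + of_int k < fst z} \<inter> {z. fst z < a (snd z) + of_int k + 1}"
    have "cyl_proj -` (cyl_proj ` K) = (UNIV \<times> closure ?I) \<inter> - ?O"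
    proof (intro set_eqI iffI)
      fix z assume "z \<in> cyl_proj -` (cyl_proj ` K)"
      then obtain x h and k :: int where z: "z = (x, h)" and h: "h \<in> closure ?I"
        and x: "a h \<le> x + of_int k" "x + of_int k \<le> b h"
        unfolding cyl_proj_preimage_image K_def by auto
      have "\<not> (b h + of_int j < x \<and> x < a h + of_int j + 1)" for j :: int
      proof
        assume j: "b h + of_int j < x \<and> x < a h + of_int j + 1"
        then have "b h + of_int (j + k) < b h" "a h < a h + of_int (j + k + 1)" using x by auto
        then have "j + k < 0" "0 < j + k + 1" by auto
        then show False by simp
      qed
      then show "z \<in> (UNIV \<times> closure ?I) \<inter> - ?O" using z h by auto
    next
      fix z assume z0: "z \<in> (UNIV \<times> closure ?I) \<inter> - ?O"
      obtain x h where z: "z = (x, h)" by (cases z)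
      define j where "j = \<lfloor>x - a h\<rfloor>"
      have j: "a h + of_int j \<le> x" "x < a h + of_int j + 1"
        unfolding j_def by linarith+
      moreover have "\<not> (b h + of_int j < x \<and> x < a h + of_int j + 1)" using z0 z by auto
      ultimately have "x \<le> b h + of_int j" by linarith
      then show "z \<in> cyl_proj -` (cyl_proj ` K)"
        using z z0 j(1) unfolding cyl_proj_preimage_image K_def by (auto intro!: exI[of _ "- j"])
    qed
    moreover have "open ?O"
      by (auto intro!: open_Int open_Collect_less ca' cb' continuous_intros)
    ultimately show ?thesis
      by (simp only: closed_Int closed_Times closed_Compl closed_closure closed_UNIV)
  qed
  then have "closedin (top_of_set cylinder) (cyl_proj ` K)" by (rule closedin_cyl_proj_image)
  moreover have "?C \<subseteq> cyl_proj ` K"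
  proof
    fix y assume "y \<in> ?C"
    then obtain x h where y: "y = cyl_proj (x, h)" and xh: "a h < x \<and> x < b h \<or> h \<in> Z" by auto
    show "y \<in> cyl_proj ` K"
    proof (cases "h \<in> Z")
      case True
      let ?j = "\<lfloor>x - a h\<rfloor>"
      have "a h \<le> x + of_int (- ?j)" "x + of_int (- ?j) \<le> b h"
        using bZ[OF True] by (simp; linarith)+
      then have "(x + of_int (- ?j), h) \<in> K" using True Z closure_subset[of ?I] unfolding K_def by auto
      then show ?thesis using y lift by (metis imageI)
    next
      case False
      then have "(x, h) \<in> K" using xh closure_subset[of ?I] unfolding K_def by auto
      then show ?thesis using y by auto
    qed
  qed
  ultimately have cl: "top_of_set cylinder closure_of ?C \<subseteq> cyl_proj ` K"
    by (rule closure_of_minimal[rotated])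
  have fr: "(top_of_set cylinder) frontier_of ?C = top_of_set cylinder closure_of ?C - ?C"
    using oC by (simp add: frontier_of_def interior_of_openin)
  show ?thesis
  proof (intro set_eqI iffI)
    fix y assume "y \<in> (top_of_set cylinder) frontier_of ?C"
    then have "y \<in> cyl_proj ` K" and nC: "y \<notin> ?C" using fr cl by auto
    then obtain x h where y: "y = cyl_proj (x, h)" and K: "(x, h) \<in> K" by auto
    have "(x, h) \<notin> ?R \<union> UNIV \<times> Z" using nC y by blast
    then have "(x, h) \<in> ?F" using K unfolding K_def by auto
    then show "y \<in> cyl_proj ` ?F" using y by auto
  next
    fix y assume "y \<in> cyl_proj ` ?F"
    then obtain x h where y: "y = cyl_proj (x, h)" and h: "h \<in> closure ?I" "h \<notin> Z"
      and x: "x = a h \<or> x = b h" by auto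
    have nC: "y \<notin> ?C"
    proof
      assume "y \<in> ?C"
      then have "(x, h) \<in> cyl_proj -` ?C" using y by simp
      then obtain k :: int where k: "a h < x + of_int k" "x + of_int k < b h"
        using h unfolding cyl_proj_preimage_image by auto
      from x show False
      proof
        assume "x = a h"
        then have "0 < (of_int k :: real)" "of_int k < (1::real)" using k ab(2)[of h] by linarith+
        then show False by simp
      next
        assume "x = b h"
        then have "(of_int k :: real) < 0" "-1 < (of_int k :: real)" using k ab(2)[of h] by linarith+
        then show False by simp
      qed
    qed
    \<comment> \<open>Over \<open>?I\<close> a boundary point is a limit along its own horizontal
      segment; at the ends of \<open>?I\<close> it is a limit along the boundary curve.\<close>
    have inR: "(a h, h) \<in> closure ?R \<and> (b h, h) \<in> closure ?R" if "h \<in> ?I" for h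
    proof -
      have l: "a h < b h" using that by simp
      have "(\<lambda>x. (x, h)) ` closure {a h <..< b h} \<subseteq> closure ((\<lambda>x. (x, h)) ` {a h <..< b h})"
        by (rule continuous_image_closure_subset[of UNIV]) (auto intro: continuous_intros)
      also have "\<dots> \<subseteq> closure ?R" by (rule closure_mono) auto
      finally show ?thesis using l by auto
    qed
    have "(\<lambda>h. (a h, h)) ` closure ?I \<subseteq> closure ((\<lambda>h. (a h, h)) ` ?I)"
      "(\<lambda>h. (b h, h)) ` closure ?I \<subseteq> closure ((\<lambda>h. (b h, h)) ` ?I)"
      by (rule continuous_image_closure_subset[of UNIV]; auto intro!: continuous_intros ca cb)+
    moreover have "closure ((\<lambda>h. (a h, h)) ` ?I) \<subseteq> closure ?R" "closure ((\<lambda>h. (b h, h)) ` ?I) \<subseteq> closure ?R"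
      using inR by (intro closure_minimal; auto)+
    ultimately have "(x, h) \<in> closure ?R" using h x by auto
    then have "(x, h) \<in> closure (?R \<union> UNIV \<times> Z)" using closure_mono[of ?R "?R \<union> UNIV \<times> Z"] by auto
    moreover have "continuous_map euclidean (top_of_set cylinder) cyl_proj"
      using quotient_map_cyl_proj quotient_imp_continuous_map by blast
    ultimately have "y \<in> top_of_set cylinder closure_of ?C"
      unfolding y using continuous_map_image_closure_subset[of euclidean "top_of_set cylinder" cyl_proj "?R \<union> UNIV \<times> Z"] by auto
    then show "y \<in> (top_of_set cylinder) frontier_of ?C" using fr nC by auto
  qed
qed

section \<open>Hat functions centred at the levels, a partition of unity\<close>

text \<open>
  The height \<open>h\<close> is clamped to the range of the drawing, so that functions interpolated with
  these weights continue as constants above and below it.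
\<close>

definition tent :: "nat \<Rightarrow> nat \<Rightarrow> real \<Rightarrow> real" where
  "tent m i h = max 0 (1 - \<bar>max 0 (min (real m) (h + 1)) - real i\<bar>)"

lemma tent_nonneg: "0 \<le> tent m i h"
  by (simp add: tent_def)

lemma continuous_on_tent: "continuous_on A (tent m i)"
  unfolding tent_def by (intro continuous_intros)

lemma tent_inner:
  assumes "j < m" "real j - 1 \<le> h" "h \<le> real j"
  shows "tent m i h = (if i = j then real j - h else if i = Suc j then h + 1 - real j else 0)"
proof -
  have u: "max 0 (min (real m) (h + 1)) = h + 1" using assms by auto
  consider "i = j" | "i = Suc j" | "i < j" | "i > Suc j" by linarith
  then show ?thesis
  proof cases
    case 3 then have "real i + 1 \<le> real j" by linarith
    then show ?thesis using assms 3 unfolding tent_def u by auto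
  next
    case 4 then have "real i \<ge> real j + 2" by linarith
    then show ?thesis using assms 4 unfolding tent_def u by auto
  qed (use assms in \<open>auto simp: tent_def u\<close>)
qed

lemma tent_below: "h \<le> -1 \<Longrightarrow> tent m i h = (if i = 0 then 1 else 0)"
  by (auto simp: tent_def)

lemma tent_above: "h \<ge> real m - 1 \<Longrightarrow> i \<le> m \<Longrightarrow> tent m i h = (if i = m then 1 else 0)"
  by (auto simp: tent_def)

lemma tent_pos_iff:
  assumes "0 < i" "i < m"
  shows "tent m i h > 0 \<longleftrightarrow> real i - 2 < h \<and> h < real i"
  using assms unfolding tent_def by (auto simp: max_def min_def abs_if)

lemma tent_0_pos_iff: "0 < m \<Longrightarrow> tent m 0 h > 0 \<longleftrightarrow> h < 0"
  unfolding tent_def by (auto simp: max_def min_def abs_if)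

lemma tent_top_pos_iff: "0 < m \<Longrightarrow> tent m m h > 0 \<longleftrightarrow> real m - 2 < h"
  unfolding tent_def by (auto simp: max_def min_def abs_if)

lemma sum_tent_inner:
  assumes "j < m" "real j - 1 \<le> h" "h \<le> real j"
  shows "(\<Sum>i\<le>m. f i * tent m i h) = f j * (real j - h) + f (Suc j) * (h + 1 - real j)"
proof -
  have "(\<Sum>i\<le>m. f i * tent m i h) = (\<Sum>i\<le>m. (if i = j then f j * (real j - h) else 0) +
    (if i = Suc j then f (Suc j) * (h + 1 - real j) else 0))"
    by (rule sum.cong) (auto simp: tent_inner[OF assms])
  also have "\<dots> = f j * (real j - h) + f (Suc j) * (h + 1 - real j)"
    using assms(1) by (simp add: sum.distrib)
  finally show ?thesis .
qed

lemma sum_tent_below: "h \<le> -1 \<Longrightarrow> (\<Sum>i\<le>m. f i * tent m i h) = f 0"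
  by (simp add: tent_below if_distrib cong: if_cong)

lemma sum_tent_above: "h \<ge> real m - 1 \<Longrightarrow> (\<Sum>i\<le>m. f i * tent m i h) = f m"
proof -
  assume "h \<ge> real m - 1"
  then have "(\<Sum>i\<le>m. f i * tent m i h) = (\<Sum>i\<le>m. if i = m then f m else 0)"
    by (intro sum.cong) (auto simp: tent_above)
  then show ?thesis by simp
qed

lemma tent_height_cases:
  assumes "0 < m"
  obtains "h < -1" | "h > real m - 1" | j where "j < m" "real j - 1 \<le> h" "h \<le> real j"
proof (cases "h < -1 \<or> h > real m - 1")
  case True then show ?thesis using that by blast
next
  case False
  \<comment> \<open>The topmost height belongs to the last strip, where rounding down would give
    \<open>m\<close>.\<close>
  define j where "j = (if h = real m - 1 then m - 1 else nat \<lfloor>h + 1\<rfloor>)"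
  have "j < m" "real j - 1 \<le> h" "h \<le> real j"
  proof -
    have "j < m \<and> real j - 1 \<le> h \<and> h \<le> real j"
    proof (cases "h = real m - 1")
      case True then show ?thesis using assms unfolding j_def by (auto simp: of_nat_diff)
    next
      case h: False
      have f: "of_int \<lfloor>h + 1\<rfloor> \<le> h + 1" "h + 1 < of_int \<lfloor>h + 1\<rfloor> + 1" by linarith+
      have "0 \<le> \<lfloor>h + 1\<rfloor>" using False by linarith
      then have rj: "real j = of_int \<lfloor>h + 1\<rfloor>" unfolding j_def using h by simp
      have "real j < real m" using rj f(1) False h by linarith
      then show ?thesis using rj f by auto
    qed
    then show "j < m" "real j - 1 \<le> h" "h \<le> real j" by auto
  qed
  then show ?thesis by (rule that(3))
qed

lemma sum_tent_eq_1: "0 < m \<Longrightarrow> (\<Sum>i\<le>m. tent m i h) = 1"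
proof -
  assume "0 < m"
  then have "(\<Sum>i\<le>m. 1 * tent m i h) = 1"
    by (cases rule: tent_height_cases[of m h])
      (simp_all only: sum_tent_below sum_tent_above sum_tent_inner less_imp_le, auto)
  then show ?thesis by simp
qed

section \<open>Labelled positions and the straight-line embedding\<close>

text \<open>
  Level \<open>i\<close> is drawn at height \<open>i - 1\<close>; \<open>lab i \<tau>\<close> is the element of level \<open>i\<close> on the
  sweeping path at time \<open>\<tau>\<close>, and \<open>X i \<tau>\<close> its position in the universal cover. The assumption
  \<open>edge_lift\<close> ensures that no edge would be drawn twice with different winding. The single bottom
  and top elements are re-entered together with the flip of a neighbouring level, which is why
  \<open>flip\<close> allows those levels to move as well.
\<close>

locale strip =
  fixes m :: nat and M :: int and V :: "'v::order set" and \<rho> :: "'v \<Rightarrow> int"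
    and lab :: "nat \<Rightarrow> int \<Rightarrow> 'v" and X :: "nat \<Rightarrow> int \<Rightarrow> real"
  assumes m: "2 \<le> m" and M: "0 < M"
    and period: "X i (\<tau> + M) = X i \<tau> + 1"
    and step_le: "X i \<tau> \<le> X i (\<tau> + 1)"
    and lab_eq_iff: "i \<le> m \<Longrightarrow> lab i \<tau> = lab i \<sigma> \<longleftrightarrow> X i \<tau> - X i \<sigma> \<in> \<int>"
    and V_eq: "V = {lab i \<tau> | i \<tau>. i \<le> m}"
    and rank: "i \<le> m \<Longrightarrow> \<rho> (lab i \<tau>) = int i - 1"
    and lab_less: "i < m \<Longrightarrow> lab i \<tau> < lab (Suc i) \<tau>"
    and edge_lift: "i < m \<Longrightarrow> lab i \<tau> = lab i \<sigma> \<Longrightarrow> lab (Suc i) \<tau> = lab (Suc i) \<sigma> \<Longrightarrow>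
      X i \<tau> - X i \<sigma> = X (Suc i) \<tau> - X (Suc i) \<sigma>"
    and lab_bot: "lab 0 \<tau> = lab 0 \<sigma>" and lab_top: "lab m \<tau> = lab m \<sigma>"
    and flip: "i \<le> m \<Longrightarrow> X i \<tau> \<noteq> X i (\<tau> + 1) \<Longrightarrow>
      \<exists>l. 0 < l \<and> l < m \<and> X l \<tau> \<noteq> X l (\<tau> + 1) \<and> lab l \<tau> \<noteq> lab l (\<tau> + 1) \<and>
        (\<forall>i. 0 < i \<and> i < m \<and> i \<noteq> l \<longrightarrow> X i (\<tau> + 1) = X i \<tau>) \<and>
        (X 0 \<tau> \<noteq> X 0 (\<tau> + 1) \<longrightarrow> l = 1) \<and> (X m \<tau> \<noteq> X m (\<tau> + 1) \<longrightarrow> Suc l = m)"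
begin

lemma period_mult: "X i (\<tau> + k * M) = X i \<tau> + of_int k"
proof (induction k rule: int_induct[of _ 0])
  case (step1 k) then show ?case using period[of i "\<tau> + k * M"] by (simp add: algebra_simps)
next
  case (step2 k) then show ?case using period[of i "\<tau> + (k - 1) * M"] by (simp add: algebra_simps)
qed simp

lemma X_mono: "\<tau> \<le> \<sigma> \<Longrightarrow> X i \<tau> \<le> X i \<sigma>"
proof (induction \<sigma> rule: int_ge_induct)
  case (step \<sigma>) then show ?case using step_le[of i \<sigma>] by simp
qed simp

lemma lab_shift: "i \<le> m \<Longrightarrow> lab i (\<tau> + k * M) = lab i \<tau>"
  unfolding lab_eq_iff period_mult by simp

text \<open>The lift to the universal cover of the polygonal path through the elements at time
  \<open>\<tau>\<close>. Having it at all heights at once lets the faces be described as regions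
  between successive paths.\<close>

definition sweep :: "int \<Rightarrow> real \<Rightarrow> real" where
  "sweep \<tau> h = (\<Sum>i\<le>m. X i \<tau> * tent m i h)"

lemma continuous_on_sweep: "continuous_on A (sweep \<tau>)"
  unfolding sweep_def by (intro continuous_intros continuous_on_tent)

lemma sweep_shift: "sweep (\<tau> + k * M) h = sweep \<tau> h + of_int k"
  unfolding sweep_def period_mult using sum_tent_eq_1[of m h] m
  by (simp add: algebra_simps sum.distrib flip: sum_distrib_left)

lemma sweep_mono: "\<tau> \<le> \<sigma> \<Longrightarrow> sweep \<tau> h \<le> sweep \<sigma> h"
  unfolding sweep_def by (intro sum_mono mult_right_mono X_mono tent_nonneg)

lemma sweep_step_le_1: "sweep (\<tau> + 1) h \<le> sweep \<tau> h + 1"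
  using sweep_mono[of "\<tau> + 1" "\<tau> + 1 * M" h] M sweep_shift[of \<tau> 1 h] by simp

text \<open>Positions never move back, so the difference is a sum of nonnegative terms and vanishes
  only if every term does.\<close>

lemma sweep_less_iff:
  assumes "\<tau> \<le> \<sigma>"
  shows "sweep \<tau> h < sweep \<sigma> h \<longleftrightarrow> (\<exists>i\<le>m. X i \<tau> \<noteq> X i \<sigma> \<and> 0 < tent m i h)"
proof -
  have nn: "0 \<le> (X i \<sigma> - X i \<tau>) * tent m i h" for i
    using X_mono[OF assms] tent_nonneg by simp
  have "sweep \<sigma> h - sweep \<tau> h = (\<Sum>i\<le>m. (X i \<sigma> - X i \<tau>) * tent m i h)"
    unfolding sweep_def by (simp add: sum_subtractf algebra_simps)
  moreover have "(\<Sum>i\<le>m. (X i \<sigma> - X i \<tau>) * tent m i h) \<noteq> 0 \<longleftrightarrow>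
    (\<exists>i\<le>m. X i \<tau> \<noteq> X i \<sigma> \<and> 0 < tent m i h)"
    using nn tent_nonneg[of m _ h] by (subst sum_nonneg_eq_0_iff) (auto simp: less_le Bex_def)
  ultimately show ?thesis using sweep_mono[OF assms, of h] by auto
qed

definition pt :: "nat \<Rightarrow> int \<Rightarrow> complex \<times> real" where
  "pt i \<tau> = cyl_proj (X i \<tau>, real i - 1)"

text \<open>An element carries one label for each time at which it is on the path. The choice among
  them is harmless by \<open>pos_lab\<close>, and in the case of \<open>seg\<close> by
  \<open>seg_lab\<close>.\<close>

definition pos :: "'v \<Rightarrow> complex \<times> real" where
  "pos v = (SOME p. \<exists>i \<tau>. i \<le> m \<and> v = lab i \<tau> \<and> p = pt i \<tau>)"

definition edge_arc :: "nat \<Rightarrow> int \<Rightarrow> (complex \<times> real) set" where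
  "edge_arc i \<tau> = (\<lambda>h. cyl_proj (sweep \<tau> h, h)) ` {real i - 1..real i}"

definition seg :: "'v \<times> 'v \<Rightarrow> (complex \<times> real) set" where
  "seg e = (SOME A. \<exists>i \<tau>. i < m \<and> e = (lab i \<tau>, lab (Suc i) \<tau>) \<and> A = edge_arc i \<tau>)"

definition edges :: "('v \<times> 'v) set" where
  "edges = {(lab i \<tau>, lab (Suc i) \<tau>) | i \<tau>. i < m}"

lemma pt_eq_iff: "pt i \<tau> = pt j \<sigma> \<longleftrightarrow> i = j \<and> X i \<tau> - X j \<sigma> \<in> \<int>"
proof -
  have "(\<exists>k::int. X i \<tau> = X i \<sigma> + of_int k) \<longleftrightarrow> X i \<tau> - X i \<sigma> \<in> \<int>"
    by (auto simp: Ints_def algebra_simps)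
  then show ?thesis unfolding pt_def cyl_proj_eq_iff by auto
qed

lemma lab_level: "i \<le> m \<Longrightarrow> j \<le> m \<Longrightarrow> lab i \<tau> = lab j \<sigma> \<Longrightarrow> i = j"
  using rank[of i \<tau>] rank[of j \<sigma>] by simp

lemma pos_lab: "i \<le> m \<Longrightarrow> pos (lab i \<tau>) = pt i \<tau>"
proof -
  assume i: "i \<le> m"
  have "\<exists>j \<sigma>. j \<le> m \<and> lab i \<tau> = lab j \<sigma> \<and> pos (lab i \<tau>) = pt j \<sigma>"
    unfolding pos_def by (rule someI_ex) (use i in blast)
  then show ?thesis using lab_level[OF i] lab_eq_iff[OF i] pt_eq_iff by metis
qed

lemma sweep_inner:
  "i < m \<Longrightarrow> real i - 1 \<le> h \<Longrightarrow> h \<le> real i \<Longrightarrow> sweep \<tau> h = X i \<tau> * (real i - h) + X (Suc i) \<tau> * (h + 1 - real i)"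
  unfolding sweep_def by (rule sum_tent_inner)

lemma sweep_vertex: "i \<le> m \<Longrightarrow> sweep \<tau> (real i - 1) = X i \<tau>"
  by (cases "i < m") (simp add: sweep_inner, simp add: sweep_def sum_tent_above)

lemma cyl_proj_sweep_vertex: "i \<le> m \<Longrightarrow> cyl_proj (sweep \<tau> (real i - 1), real i - 1) = pt i \<tau>"
  by (simp add: sweep_vertex pt_def)

text \<open>By \<open>edge_lift\<close> both ends are shifted by the same integer, hence so is the
  whole segment between them.\<close>

lemma edge_arc_cong:
  assumes i: "i < m" and e: "lab i \<tau> = lab i \<sigma>" "lab (Suc i) \<tau> = lab (Suc i) \<sigma>"
  shows "edge_arc i \<tau> = edge_arc i \<sigma>"
proof -
  obtain k :: int where k: "X i \<tau> - X i \<sigma> = of_int k"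
    using e(1) lab_eq_iff[of i] i by (auto elim: Ints_cases)
  then have k': "X i \<tau> = X i \<sigma> + of_int k" "X (Suc i) \<tau> = X (Suc i) \<sigma> + of_int k"
    using edge_lift[OF i e] by auto
  have "sweep \<tau> h = sweep \<sigma> h + of_int k" if "real i - 1 \<le> h" "h \<le> real i" for h
    using that i by (simp add: sweep_inner k' algebra_simps)
  then show ?thesis unfolding edge_arc_def
    by (intro image_cong) (auto simp: cyl_proj_eq_iff)
qed

lemma seg_lab: "i < m \<Longrightarrow> seg (lab i \<tau>, lab (Suc i) \<tau>) = edge_arc i \<tau>"
proof -
  assume i: "i < m"
  have "\<exists>j \<sigma>. j < m \<and> (lab i \<tau>, lab (Suc i) \<tau>) = (lab j \<sigma>, lab (Suc j) \<sigma>) \<and>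
      seg (lab i \<tau>, lab (Suc i) \<tau>) = edge_arc j \<sigma>"
    unfolding seg_def by (rule someI_ex) (use i in blast)
  then obtain j \<sigma> where "j < m" "lab i \<tau> = lab j \<sigma>" "lab (Suc i) \<tau> = lab (Suc j) \<sigma>"
    and s: "seg (lab i \<tau>, lab (Suc i) \<tau>) = edge_arc j \<sigma>" by auto
  moreover from this have "i = j" using lab_level i by simp
  ultimately show ?thesis using edge_arc_cong i by metis
qed

lemma edge_arc_eq_segment:
  assumes "i < m"
  shows "edge_arc i \<tau> = cyl_proj ` closed_segment (X i \<tau>, real i - 1) (X (Suc i) \<tau>, real i)"
proof -
  have "(\<lambda>h. (sweep \<tau> h, h)) ` {real i - 1..real i} = closed_segment (X i \<tau>, real i - 1) (X (Suc i) \<tau>, real i)"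
  proof (intro set_eqI iffI)
    fix z assume "z \<in> (\<lambda>h. (sweep \<tau> h, h)) ` {real i - 1..real i}"
    then obtain h where "z = (sweep \<tau> h, h)" "real i - 1 \<le> h" "h \<le> real i" by auto
    then show "z \<in> closed_segment (X i \<tau>, real i - 1) (X (Suc i) \<tau>, real i)"
      using assms unfolding in_segment
      by (intro exI[of _ "h + 1 - real i"]) (auto simp: sweep_inner algebra_simps)
  next
    fix z assume "z \<in> closed_segment (X i \<tau>, real i - 1) (X (Suc i) \<tau>, real i)"
    then obtain u where u: "0 \<le> u" "u \<le> 1"
      and z: "z = (1 - u) *\<^sub>R (X i \<tau>, real i - 1) + u *\<^sub>R (X (Suc i) \<tau>, real i)"
      unfolding in_segment by auto
    have "z = (sweep \<tau> (real i - 1 + u), real i - 1 + u)"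
      using u assms by (simp add: z sweep_inner algebra_simps)
    then show "z \<in> (\<lambda>h. (sweep \<tau> h, h)) ` {real i - 1..real i}" using u by auto
  qed
  then show ?thesis unfolding edge_arc_def by (metis (no_types, lifting) image_cong image_image)
qed

lemma edge_arc_at_height:
  assumes "i < m" "z \<in> edge_arc i \<tau>" "snd z = real j - 1" "j \<le> m"
  shows "(j = i \<or> j = Suc i) \<and> z = pt j \<tau>"
proof -
  obtain h where h: "real i - 1 \<le> h" "h \<le> real i" "z = cyl_proj (sweep \<tau> h, h)"
    using assms(2) unfolding edge_arc_def by auto
  then have "h = real j - 1" using assms(3) by (simp add: cyl_proj_def)
  moreover from this have "i \<le> j" "j \<le> Suc i" using h by linarith+
  ultimately show ?thesis using h cyl_proj_sweep_vertex[OF assms(4)] by auto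
qed

text \<open>At the height of a level an arc contains nothing but a vertex. Strictly between levels,
  shift one time by whole turns until the two paths meet in the plane. As positions are monotone in
  time, paths that agree at one inner height agree at both ends of the edge, so the edges
  coincide.\<close>

lemma edge_arcs_meet:
  assumes i: "i < m" and z: "z \<in> edge_arc i \<tau>" "z \<in> edge_arc j \<sigma>" and j: "j < m"
    and ne: "(lab i \<tau>, lab (Suc i) \<tau>) \<noteq> (lab j \<sigma>, lab (Suc j) \<sigma>)"
  shows "z \<in> pos ` ({lab i \<tau>, lab (Suc i) \<tau>} \<inter> {lab j \<sigma>, lab (Suc j) \<sigma>})"
proof -
  obtain h where h: "real i - 1 \<le> h" "h \<le> real i" and zh: "z = cyl_proj (sweep \<tau> h, h)"
    using z unfolding edge_arc_def by auto
  obtain h' where h': "real j - 1 \<le> h'" "h' \<le> real j" and zh': "z = cyl_proj (sweep \<sigma> h', h')"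
    using z unfolding edge_arc_def by auto
  have hh: "h' = h" using zh zh' by (simp add: cyl_proj_def)
  show ?thesis
  proof (cases "\<exists>l\<le>m. h = real l - 1")
    case True
    then obtain l where l: "l \<le> m" "snd z = real l - 1" using zh by (auto simp: cyl_proj_def)
    have a: "(l = i \<or> l = Suc i) \<and> z = pt l \<tau>" using edge_arc_at_height[OF i z(1) l(2,1)] .
    have b: "(l = j \<or> l = Suc j) \<and> z = pt l \<sigma>" using edge_arc_at_height[OF j z(2) l(2,1)] .
    have "lab l \<tau> = lab l \<sigma>" using a b pt_eq_iff[of l \<tau> l \<sigma>] lab_eq_iff[OF l(1)] by simp
    then have "lab l \<tau> \<in> {lab i \<tau>, lab (Suc i) \<tau>} \<inter> {lab j \<sigma>, lab (Suc j) \<sigma>}"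
      using a b by auto
    moreover have "z = pos (lab l \<tau>)" using a pos_lab[OF l(1)] by simp
    ultimately show ?thesis by blast
  next
    case False
    have "h \<noteq> real i - 1" "h \<noteq> real (Suc i) - 1" using False i
      by (metis Suc_leI less_imp_le)+
    then have hi: "real i - 1 < h" "h < real i" using h by auto
    then have ij: "i = j" using h' hh by linarith
    obtain k :: int where k: "sweep \<tau> h = sweep \<sigma> h + of_int k"
      using cyl_proj_eq_iff[of "(sweep \<tau> h, h)" "(sweep \<sigma> h, h)"] zh zh' hh by auto
    let ?s = "\<sigma> + k * M"
    have eq: "sweep \<tau> h = sweep ?s h" using k sweep_shift by simp
    have pos: "tent m i h > 0" "tent m (Suc i) h > 0" using tent_inner[OF i h] hi by auto
    have "X l \<tau> = X l ?s" if "l \<in> {i, Suc i}" for l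
    proof -
      have "l \<le> m" "0 < tent m l h" using that pos i by auto
      moreover have "\<tau> \<le> ?s \<or> ?s \<le> \<tau>" by linarith
      ultimately show ?thesis
        using sweep_less_iff[of \<tau> ?s h] sweep_less_iff[of ?s \<tau> h] eq by fastforce
    qed
    then have "lab l \<tau> = lab l \<sigma>" if "l \<in> {i, Suc i}" for l
      using that i lab_shift[of l \<sigma> k] lab_eq_iff[of l \<tau> ?s] by auto
    then show ?thesis using ne ij by auto
  qed
qed

lemma embedding: "straight_cylinder_embedding V edges \<rho> pos seg"
  unfolding straight_cylinder_embedding_def
proof (intro conjI)
  show "inj_on pos V"
    unfolding V_eq by (rule inj_onI) (auto simp: pos_lab pt_eq_iff lab_eq_iff)
  show "\<forall>x\<in>V. pos x \<in> cylinder \<and> snd (pos x) = real_of_int (\<rho> x)"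
    by (auto simp: V_eq pos_lab rank pt_def cyl_proj_def cylinder_def)
  show "\<forall>(x, y)\<in>edges. \<exists>p q. cyl_proj p = pos x \<and> cyl_proj q = pos y \<and>
                    seg (x, y) = cyl_proj ` closed_segment p q"
  proof clarify
    fix x y assume "(x, y) \<in> edges"
    then obtain i \<tau> where i: "i < m" and xy: "x = lab i \<tau>" "y = lab (Suc i) \<tau>" unfolding edges_def by auto
    show "\<exists>p q. cyl_proj p = pos x \<and> cyl_proj q = pos y \<and> seg (x, y) = cyl_proj ` closed_segment p q"
      unfolding xy seg_lab[OF i] edge_arc_eq_segment[OF i]
      by (intro exI[of _ "(X i \<tau>, real i - 1)"] exI[of _ "(X (Suc i) \<tau>, real i)"])
        (use i in \<open>auto simp: pos_lab pt_def\<close>)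
  qed
  show "\<forall>(x, y)\<in>edges. \<forall>v\<in>V. pos v \<in> seg (x, y) \<longrightarrow> v = x \<or> v = y"
  proof (clarify)
    fix x y v assume "(x, y) \<in> edges" and v: "v \<in> V" and p: "pos v \<in> seg (x, y)" and ny: "v \<noteq> y"
    then obtain i \<tau> where i: "i < m" and xy: "x = lab i \<tau>" "y = lab (Suc i) \<tau>" unfolding edges_def by auto
    obtain j \<sigma> where j: "j \<le> m" and vj: "v = lab j \<sigma>" using v V_eq by auto
    have "pt j \<sigma> \<in> edge_arc i \<tau>" using p vj xy seg_lab[OF i] pos_lab[OF j] by simp
    moreover have "snd (pt j \<sigma>) = real j - 1" by (simp add: pt_def cyl_proj_def)
    ultimately have "(j = i \<or> j = Suc i) \<and> pt j \<sigma> = pt j \<tau>"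
      using edge_arc_at_height[OF i _ _ j] by blast
    then have "(j = i \<or> j = Suc i) \<and> v = lab j \<tau>" using pt_eq_iff lab_eq_iff[OF j] vj by auto
    then show "v = x" using ny xy by auto
  qed
  show "\<forall>(x, y)\<in>edges. \<forall>(x', y')\<in>edges. (x, y) \<noteq> (x', y') \<longrightarrow>
        seg (x, y) \<inter> seg (x', y') \<subseteq> pos ` ({x, y} \<inter> {x', y'})"
  proof (unfold split_beta, intro ballI impI subsetI)
    fix e e' z assume e: "e \<in> edges" "e' \<in> edges" and ne: "(fst e, snd e) \<noteq> (fst e', snd e')"
      and z: "z \<in> seg (fst e, snd e) \<inter> seg (fst e', snd e')"
    obtain i \<tau> where i: "i < m" and xy: "e = (lab i \<tau>, lab (Suc i) \<tau>)" using e unfolding edges_def by auto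
    obtain j \<sigma> where j: "j < m" and xy': "e' = (lab j \<sigma>, lab (Suc j) \<sigma>)" using e unfolding edges_def by auto
    show "z \<in> pos ` ({fst e, snd e} \<inter> {fst e', snd e'})"
      using edge_arcs_meet[OF i _ _ j, of z \<tau> \<sigma>] z ne seg_lab i j unfolding xy xy' by simp
  qed
qed

text \<open>The drawing is the union of all sweeping paths, so a point off it but within its heights
  lies strictly between two successive paths.\<close>

lemma drawing_eq: "pos ` V \<union> \<Union> (seg ` edges) = {cyl_proj (sweep \<tau> h, h) | \<tau> h. -1 \<le> h \<and> h \<le> real m - 1}"
proof (intro set_eqI iffI)
  fix z assume "z \<in> pos ` V \<union> \<Union> (seg ` edges)"
  then show "z \<in> {cyl_proj (sweep \<tau> h, h) | \<tau> h. -1 \<le> h \<and> h \<le> real m - 1}"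
  proof
    assume "z \<in> pos ` V"
    then obtain i \<tau> where i: "i \<le> m" and z: "z = pt i \<tau>" unfolding V_eq by (auto simp: pos_lab)
    have "z = cyl_proj (sweep \<tau> (real i - 1), real i - 1)" using cyl_proj_sweep_vertex[OF i] z by simp
    then show ?thesis using i by fastforce
  next
    assume "z \<in> \<Union> (seg ` edges)"
    then obtain i \<tau> where i: "i < m" and z: "z \<in> edge_arc i \<tau>" unfolding edges_def by (auto simp: seg_lab)
    then obtain h where "real i - 1 \<le> h" "h \<le> real i" "z = cyl_proj (sweep \<tau> h, h)" unfolding edge_arc_def by auto
    moreover have "real i \<le> real m - 1" using i by linarith
    ultimately show ?thesis by fastforce
  qed
next
  fix z assume "z \<in> {cyl_proj (sweep \<tau> h, h) | \<tau> h. -1 \<le> h \<and> h \<le> real m - 1}"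
  then obtain \<tau> h where z: "z = cyl_proj (sweep \<tau> h, h)" and h: "-1 \<le> h" "h \<le> real m - 1" by auto
  obtain j where j: "j < m" "real j - 1 \<le> h" "h \<le> real j"
    using tent_height_cases[of m h thesis] m h by auto
  then have "z \<in> edge_arc j \<tau>" using z unfolding edge_arc_def by auto
  moreover have "(lab j \<tau>, lab (Suc j) \<tau>) \<in> edges" using j unfolding edges_def by auto
  ultimately show "z \<in> pos ` V \<union> \<Union> (seg ` edges)" using seg_lab[OF j(1)] by blast
qed

section \<open>The faces of the drawing\<close>

text \<open>
  Beyond the drawing the sweeping paths run along the same ray above the top vertex (below the
  bottom vertex), which is not part of the drawing and must be added to the unbounded faces.
\<close>

definition ray_heights :: "int \<Rightarrow> real set" where
  "ray_heights \<tau> = {h. sweep \<tau> h < sweep (\<tau> + 1) h \<and> (h < -1 \<or> real m - 1 < h)}"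

definition cell :: "int \<Rightarrow> (complex \<times> real) set" where
  "cell \<tau> = cyl_proj ` ({(x, h). sweep \<tau> h < x \<and> x < sweep (\<tau> + 1) h} \<union> UNIV \<times> ray_heights \<tau>)"

lemma cell_drawing_disjoint: "cell \<tau> \<inter> (pos ` V \<union> \<Union> (seg ` edges)) = {}"
proof (rule ccontr)
  assume "\<not> ?thesis"
  then obtain z where z: "z \<in> cell \<tau>" "z \<in> pos ` V \<union> \<Union> (seg ` edges)" by blast
  obtain x h where xh: "sweep \<tau> h < x \<and> x < sweep (\<tau> + 1) h \<or> h \<in> ray_heights \<tau>" and zx: "z = cyl_proj (x, h)"
    using z(1) unfolding cell_def by blast
  obtain \<sigma> h' where "z = cyl_proj (sweep \<sigma> h', h')" and h: "-1 \<le> h'" "h' \<le> real m - 1"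
    using z(2) unfolding drawing_eq by blast
  then have e: "cyl_proj (x, h) = cyl_proj (sweep \<sigma> h', h')" using zx by simp
  have hh: "h' = h" using e unfolding cyl_proj_eq_iff by simp
  then have "h \<notin> ray_heights \<tau>" using h unfolding ray_heights_def by auto
  then have x: "sweep \<tau> h < x" "x < sweep (\<tau> + 1) h" using xh by auto
  obtain k :: int where "x = sweep \<sigma> h + of_int k" using e hh unfolding cyl_proj_eq_iff by auto
  then have k: "x = sweep (\<sigma> + k * M) h" using sweep_shift by simp
  \<comment> \<open>No time lies strictly between \<open>\<tau>\<close> and
    \<open>\<tau> + 1\<close>, and the paths are ordered by time.\<close>
  have "\<sigma> + k * M \<le> \<tau> \<or> \<tau> + 1 \<le> \<sigma> + k * M" by linarith
  then show False
    using x k sweep_mono[of "\<sigma> + k * M" \<tau> h] sweep_mono[of "\<tau> + 1" "\<sigma> + k * M" h] by auto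
qed

lemma ex_step:
  fixes f :: "int \<Rightarrow> real"
  assumes "f \<tau> \<le> x" "x < f (\<tau> + int n)"
  shows "\<exists>\<sigma>. f \<sigma> \<le> x \<and> x < f (\<sigma> + 1)"
  using assms
proof (induction n)
  case (Suc n)
  then show ?case by (cases "x < f (\<tau> + int n)") (auto simp: algebra_simps intro: exI[of _ "\<tau> + int n"])
qed simp

lemma ex_sweep_step: "\<exists>\<sigma>. sweep \<sigma> h \<le> x \<and> x < sweep (\<sigma> + 1) h"
proof -
  \<comment> \<open>\<open>k\<close> whole turns bring the path of time 0 to within one turn to the
    left of \<open>x\<close>.\<close>
  define k where "k = \<lfloor>x - sweep 0 h\<rfloor>"
  have "sweep (k * M) h \<le> x" "x < sweep (k * M + int (nat M)) h"
    using sweep_shift[of 0 k h] sweep_shift[of 0 "k + 1" h] M unfolding k_def by (simp_all add: algebra_simps; linarith)+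
  then show ?thesis by (rule ex_step)
qed

lemma cells_cover:
  assumes "z \<in> cylinder - (pos ` V \<union> \<Union> (seg ` edges))"
  shows "\<exists>\<tau>. z \<in> cell \<tau>"
proof -
  have "z \<in> range cyl_proj" using assms unfolding cyl_proj_image by blast
  then obtain x h where z: "z = cyl_proj (x, h)" by auto
  obtain \<tau> where t: "sweep \<tau> h \<le> x" "x < sweep (\<tau> + 1) h" using ex_sweep_step by blast
  show ?thesis
  proof (cases "sweep \<tau> h < x")
    case True
    then show ?thesis using t z unfolding cell_def by blast
  next
    case False
    then have "z = cyl_proj (sweep \<tau> h, h)" using t z by auto
    then have "h < -1 \<or> real m - 1 < h" using assms unfolding drawing_eq by fastforce
    then have "h \<in> ray_heights \<tau>" using t unfolding ray_heights_def by auto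
    then show ?thesis using z unfolding cell_def by blast
  qed
qed

lemma int_step:
  assumes "x \<noteq> y" "x \<le> y" "y \<le> x + 1" "y - x \<in> \<int>"
  shows "y = x + (1::real)"
proof -
  obtain k :: int where k: "y - x = of_int k" using assms(4) by (auto elim: Ints_cases)
  then have "0 < (of_int k :: real)" "(of_int k :: real) \<le> 1" using assms by linarith+
  then have "k = 1" by simp
  then show ?thesis using k by simp
qed

text \<open>The bottom and the top are single elements, so their positions change by integers, and a
  step makes at most one turn.\<close>

lemma ray_heights_full: "h \<in> ray_heights \<tau> \<Longrightarrow> sweep (\<tau> + 1) h = sweep \<tau> h + 1"
proof -
  assume h: "h \<in> ray_heights \<tau>"
  then have "sweep \<tau> h = X 0 \<tau> \<and> sweep (\<tau> + 1) h = X 0 (\<tau> + 1) \<or> sweep \<tau> h = X m \<tau> \<and> sweep (\<tau> + 1) h = X m (\<tau> + 1)"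
    unfolding ray_heights_def sweep_def by (auto simp: sum_tent_below sum_tent_above)
  moreover have "X 0 (\<tau> + 1) - X 0 \<tau> \<in> \<int>" "X m (\<tau> + 1) - X m \<tau> \<in> \<int>"
    using lab_bot lab_top lab_eq_iff by blast+
  ultimately show ?thesis
    using h int_step[of "sweep \<tau> h" "sweep (\<tau> + 1) h"] sweep_step_le_1[of \<tau> h] unfolding ray_heights_def by auto
qed

lemma open_ray_heights: "open (ray_heights \<tau>)"
proof -
  have "ray_heights \<tau> = {h. sweep \<tau> h < sweep (\<tau> + 1) h} \<inter> ({..<-1} \<union> {real m - 1<..})" unfolding ray_heights_def by auto
  then show ?thesis by (auto intro!: open_Int open_Un open_Collect_less continuous_on_sweep)
qed

text \<open>Successive paths differ around the flipped level, and also along a ray if the bottom or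
  the top element moves too. The conditions \<open>l = 1\<close> and \<open>Suc l = m\<close> make
  the ray overlap the part around level \<open>l\<close>, so that a single interval results.\<close>

lemma moving_heights:
  assumes l: "0 < l" "l < m" "X l \<tau> \<noteq> X l (\<tau> + 1)"
    and oth: "\<And>i. 0 < i \<Longrightarrow> i < m \<Longrightarrow> i \<noteq> l \<Longrightarrow> X i (\<tau> + 1) = X i \<tau>"
    and bot: "X 0 \<tau> \<noteq> X 0 (\<tau> + 1) \<Longrightarrow> l = 1" and top: "X m \<tau> \<noteq> X m (\<tau> + 1) \<Longrightarrow> Suc l = m"
  shows "{h. sweep \<tau> h < sweep (\<tau> + 1) h} = {h. (real l - 2 < h \<or> X 0 \<tau> \<noteq> X 0 (\<tau> + 1)) \<and>
      (h < real l \<or> X m \<tau> \<noteq> X m (\<tau> + 1))}"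
proof -
  have "sweep \<tau> h < sweep (\<tau> + 1) h \<longleftrightarrow> (real l - 2 < h \<or> X 0 \<tau> \<noteq> X 0 (\<tau> + 1)) \<and>
      (h < real l \<or> X m \<tau> \<noteq> X m (\<tau> + 1))" for h
  proof -
    have "sweep \<tau> h < sweep (\<tau> + 1) h \<longleftrightarrow> (\<exists>i\<le>m. X i \<tau> \<noteq> X i (\<tau> + 1) \<and> 0 < tent m i h)"
      by (rule sweep_less_iff) simp
    also have "\<dots> \<longleftrightarrow> 0 < tent m l h \<or> (X 0 \<tau> \<noteq> X 0 (\<tau> + 1) \<and> 0 < tent m 0 h) \<or>
        (X m \<tau> \<noteq> X m (\<tau> + 1) \<and> 0 < tent m m h)"
      (is "?L \<longleftrightarrow> ?R")
    proof
      assume ?L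
      then obtain i where "i \<le> m" "X i \<tau> \<noteq> X i (\<tau> + 1)" "0 < tent m i h" by blast
      then show ?R using oth[of i] by (cases "i = 0"; cases "i = m"; cases "i = l") auto
    next
      assume ?R then show ?L using l by (metis le_refl less_imp_le zero_le)
    qed
    also have "\<dots> \<longleftrightarrow> (real l - 2 < h \<and> h < real l) \<or> (X 0 \<tau> \<noteq> X 0 (\<tau> + 1) \<and> h < 0) \<or>
        (X m \<tau> \<noteq> X m (\<tau> + 1) \<and> real m - 2 < h)"
      using l m by (simp add: tent_pos_iff tent_0_pos_iff tent_top_pos_iff)
    also have "\<dots> \<longleftrightarrow> (real l - 2 < h \<or> X 0 \<tau> \<noteq> X 0 (\<tau> + 1)) \<and> (h < real l \<or> X m \<tau> \<noteq> X m (\<tau> + 1))"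
      using bot top by (cases "X 0 \<tau> \<noteq> X 0 (\<tau> + 1)"; cases "X m \<tau> \<noteq> X m (\<tau> + 1)") auto
    finally show ?thesis .
  qed
  then show ?thesis by simp
qed

lemma cell_rhombus:
  assumes "cell \<tau> \<noteq> {}"
  shows "connected (cell \<tau>)" "is_rhombus edges \<rho> seg (cell \<tau>)"
    "(top_of_set cylinder) frontier_of (cell \<tau>) \<subseteq> pos ` V \<union> \<Union> (seg ` edges)"
proof -
  obtain x h where "sweep \<tau> h < x \<and> x < sweep (\<tau> + 1) h \<or> h \<in> ray_heights \<tau>"
    using assms unfolding cell_def by blast
  then have "sweep \<tau> h < sweep (\<tau> + 1) h" unfolding ray_heights_def by auto
  then obtain i where "i \<le> m" "X i \<tau> \<noteq> X i (\<tau> + 1)" using sweep_less_iff[of \<tau> "\<tau> + 1" h] by auto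
  from flip[OF this] obtain l where l: "0 < l" "l < m" "X l \<tau> \<noteq> X l (\<tau> + 1)" "lab l \<tau> \<noteq> lab l (\<tau> + 1)"
    and oth: "\<forall>i. 0 < i \<and> i < m \<and> i \<noteq> l \<longrightarrow> X i (\<tau> + 1) = X i \<tau>"
    and bt: "X 0 \<tau> \<noteq> X 0 (\<tau> + 1) \<longrightarrow> l = 1" "X m \<tau> \<noteq> X m (\<tau> + 1) \<longrightarrow> Suc l = m"
    by (elim exE conjE) (rule that)
  have I: "{h. sweep \<tau> h < sweep (\<tau> + 1) h} = {h. (real l - 2 < h \<or> X 0 \<tau> \<noteq> X 0 (\<tau> + 1)) \<and>
      (h < real l \<or> X m \<tau> \<noteq> X m (\<tau> + 1))}"
    by (rule moving_heights[OF l(1-3)]) (use oth bt in auto)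
  let ?b = "X 0 \<tau> \<noteq> X 0 (\<tau> + 1)" and ?t = "X m \<tau> \<noteq> X m (\<tau> + 1)"
  have lm: "real l \<le> real m - 1" "real l \<ge> 1" using l by linarith+
  have bot': "?b \<Longrightarrow> real l = 1" and top': "?t \<Longrightarrow> real m = real l + 1" using bt by auto
  have I': "{h. sweep \<tau> h < sweep (\<tau> + 1) h} = (if ?b then if ?t then UNIV else {..<real l} else
      if ?t then {real l - 2<..} else {real l - 2<..<real l})"
    unfolding I by auto
  have "connected {h. sweep \<tau> h < sweep (\<tau> + 1) h}"
    unfolding I' by auto
  moreover have Zs: "ray_heights \<tau> \<subseteq> {h. sweep \<tau> h < sweep (\<tau> + 1) h}" unfolding ray_heights_def by auto
  ultimately show "connected (cell \<tau>)"
    unfolding cell_def by (intro connected_cyl_region continuous_on_sweep)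
  \<comment> \<open>If the interval is unbounded, its part beyond the end vertex consists of ray
    heights. What remains are the edge heights just below and just above level \<open>l\<close>,
    which is drawn at height \<open>l - 1\<close>.\<close>
  have "closure {h. sweep \<tau> h < sweep (\<tau> + 1) h} - ray_heights \<tau> = {real l - 2..real l}"
  proof -
    have "closure {h. sweep \<tau> h < sweep (\<tau> + 1) h} = {h. (real l - 2 \<le> h \<or> ?b) \<and> (h \<le> real l \<or> ?t)}"
      unfolding I' by auto
    moreover have "ray_heights \<tau> = {h. (real l - 2 < h \<or> ?b) \<and> (h < real l \<or> ?t) \<and> (h < -1 \<or> real m - 1 < h)}"
      using I unfolding ray_heights_def by auto
    ultimately show ?thesis using bot' top' lm by (cases ?b; cases ?t; force)
  qed
  then have fr: "(top_of_set cylinder) frontier_of (cell \<tau>) =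
      cyl_proj ` {(x, h). h \<in> {real l - 2..real l} \<and> (x = sweep \<tau> h \<or> x = sweep (\<tau> + 1) h)}"
    using frontier_of_cyl_region[of "sweep \<tau>" "sweep (\<tau> + 1)" "ray_heights \<tau>"] Zs
    unfolding cell_def by (simp add: continuous_on_sweep sweep_mono sweep_step_le_1 open_ray_heights ray_heights_full)
  then show "(top_of_set cylinder) frontier_of (cell \<tau>) \<subseteq> pos ` V \<union> \<Union> (seg ` edges)"
    unfolding drawing_eq using lm by fastforce
  obtain k where k: "l = Suc k" using l by (cases l) auto
  \<comment> \<open>A neighbouring level that is the bottom or the top may have moved by a full
    turn, but its element is the same.\<close>
  have same: "lab k (\<tau> + 1) = lab k \<tau>" "lab (Suc l) (\<tau> + 1) = lab (Suc l) \<tau>"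
  proof -
    have "k = 0 \<or> X k (\<tau> + 1) = X k \<tau>" using oth k l by auto
    then show "lab k (\<tau> + 1) = lab k \<tau>" using lab_bot lab_eq_iff[of k] k l by auto
    have "Suc l = m \<or> X (Suc l) (\<tau> + 1) = X (Suc l) \<tau>" using oth[rule_format, of "Suc l"] l by (cases "Suc l = m") auto
    then show "lab (Suc l) (\<tau> + 1) = lab (Suc l) \<tau>" using lab_top lab_eq_iff[of "Suc l"] l by auto
  qed
  have km: "k < m" using k l by simp
  have segs: "seg (lab k \<tau>, lab l \<tau>) = edge_arc k \<tau>" "seg (lab k \<tau>, lab l (\<tau> + 1)) = edge_arc k (\<tau> + 1)"
    "seg (lab l \<tau>, lab (Suc l) \<tau>) = edge_arc l \<tau>" "seg (lab l (\<tau> + 1), lab (Suc l) \<tau>) = edge_arc l (\<tau> + 1)"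
    using seg_lab[OF km, of \<tau>] seg_lab[OF km, of "\<tau> + 1"] seg_lab[OF l(2), of \<tau>] seg_lab[OF l(2), of "\<tau> + 1"]
    same k by simp_all
  have "{(lab k \<tau>, lab l \<tau>), (lab k \<tau>, lab l (\<tau> + 1)), (lab l \<tau>, lab (Suc l) \<tau>),
      (lab l (\<tau> + 1), lab (Suc l) \<tau>)} \<subseteq> edges"
  proof -
    have e: "(lab i \<sigma>, lab (Suc i) \<sigma>) \<in> edges" if "i < m" for i \<sigma> using that unfolding edges_def by blast
    show ?thesis
      using e[OF km, of \<tau>] e[OF km, of "\<tau> + 1"] e[OF l(2), of \<tau>] e[OF l(2), of "\<tau> + 1"] same k by simp
  qed
  moreover have "(top_of_set cylinder) frontier_of (cell \<tau>) =
      edge_arc k \<tau> \<union> edge_arc k (\<tau> + 1) \<union> edge_arc l \<tau> \<union> edge_arc l (\<tau> + 1)"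
  proof -
    have "{real l - 2..real l} = {real k - 1..real k} \<union> {real l - 1..real l}" using k by auto
    then show ?thesis unfolding fr edge_arc_def by auto
  qed
  ultimately show "is_rhombus edges \<rho> seg (cell \<tau>)"
    unfolding is_rhombus_def
    by - (rule exI[of _ "lab l \<tau>"], rule exI[of _ "lab k \<tau>"], rule exI[of _ "lab l (\<tau> + 1)"],
        rule exI[of _ "lab (Suc l) \<tau>"], rule exI[of _ "int l - 1"],
        use l k in \<open>auto simp: segs[unfolded k] rank\<close>)
qed

theorem has_rhombic_strip: "has_rhombic_strip V \<rho>"
  unfolding has_rhombic_strip_def
proof (intro exI conjI ballI)
  show "edges \<subseteq> cover_graph V \<rho>"
  proof
    fix e assume "e \<in> edges"
    then obtain i \<tau> where i: "i < m" and e: "e = (lab i \<tau>, lab (Suc i) \<tau>)" unfolding edges_def by blast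
    have "lab i \<tau> \<in> V" "lab (Suc i) \<tau> \<in> V" using i unfolding V_eq by (auto simp: Suc_le_eq)
    then show "e \<in> cover_graph V \<rho>"
      using lab_less[OF i] rank i unfolding e cover_graph_def by simp
  qed
  show "straight_cylinder_embedding V edges \<rho> pos seg" by (rule embedding)
  fix C assume "C \<in> drawing_faces V edges pos seg"
  then have C: "C \<in> components (cylinder - (pos ` V \<union> \<Union> (seg ` edges)))" (is "_ \<in> components ?U")
    unfolding drawing_faces_def .
  then obtain z where z: "z \<in> C" "z \<in> ?U"
    using in_components_nonempty[OF C] in_components_subset[OF C] by blast
  then obtain \<tau> where t: "z \<in> cell \<tau>" using cells_cover by blast
  then have ne: "cell \<tau> \<noteq> {}" by auto
  note r = cell_rhombus[OF ne]
  have "cell \<tau> \<subseteq> cylinder" unfolding cell_def using cyl_proj_image by auto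
  then have "cell \<tau> \<subseteq> ?U" using cell_drawing_disjoint by blast
  then have "cell \<tau> \<subseteq> C" using components_maximal[OF C r(1)] z t by blast
  \<comment> \<open>\<open>C\<close> is connected and misses the frontier of the cell, which lies in
    the drawing, so it cannot leave the cell.\<close>
  moreover have "C \<subseteq> cell \<tau>"
  proof (rule ccontr)
    assume "\<not> C \<subseteq> cell \<tau>"
    moreover have "connectedin (top_of_set cylinder) C"
      using in_components_connected[OF C] in_components_subset[OF C]
      by (auto simp: connectedin_subtopology)
    ultimately have "C \<inter> (top_of_set cylinder) frontier_of (cell \<tau>) \<noteq> {}"
      using connectedin_Int_frontier_of z t by blast
    then show False using r(3) in_components_subset[OF C] by blast
  qed
  ultimately show "is_rhombus edges \<rho> seg C" using r(2) by simp
qed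

end

section \<open>Flags of the cube\<close>

text \<open>A word encodes a nonempty face of the cube; \<open>None\<close> marks a coordinate that varies on the face.\<close>

type_synonym word = "bool option list"

definition stars :: "word \<Rightarrow> nat" where
  "stars w = count_list w None"

lemma stars_simps [simp]: "stars [] = 0" "stars (None # w) = Suc (stars w)" "stars (Some b # w) = stars w"
  by (simp_all add: stars_def)

lemma stars_le_length: "stars w \<le> length w"
  by (simp add: stars_def count_le_length)

lemma stars_eq_length_iff: "stars w = length w \<longleftrightarrow> w = replicate (length w) None"
proof (induction w)
  case (Cons c w)
  then show ?case using stars_le_length[of w] by (cases c) auto
qed simp

definition word_le :: "word \<Rightarrow> word \<Rightarrow> bool" where
  "word_le = list_all2 (\<lambda>a b. a = b \<or> b = None)"

lemma word_le_Cons [simp]: "word_le (a # v) (b # w) \<longleftrightarrow> (a = b \<or> b = None) \<and> word_le v w"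
  by (simp add: word_le_def)

lemma word_le_refl [simp]: "word_le w w"
  by (simp add: word_le_def list_all2_refl)

text \<open>Levels are dimensions: the empty face is left out, which shifts the numbering by one
  against that of \<open>strip\<close>. Values beyond \<open>n\<close> are arbitrary.\<close>

definition is_flag :: "nat \<Rightarrow> (nat \<Rightarrow> word) \<Rightarrow> bool" where
  "is_flag n f \<longleftrightarrow> (\<forall>r\<le>n. length (f r) = n \<and> stars (f r) = r) \<and> (\<forall>r<n. word_le (f r) (f (Suc r)))"

section \<open>Entries and visits along a list\<close>

fun entries :: "('a \<Rightarrow> bool) \<Rightarrow> 'a list \<Rightarrow> nat" where
  "entries P (x # y # xs) = (if \<not> P x \<and> P y then 1 else 0) + entries P (y # xs)"
| "entries P _ = 0"

text \<open>The number of maximal runs of consecutive elements satisfying \<open>P\<close>.\<close>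

definition visits :: "('a \<Rightarrow> bool) \<Rightarrow> 'a list \<Rightarrow> nat" where
  "visits P xs = (if P (hd xs) then 1 else 0) + entries P xs"

lemma entries_split: "entries P (xs @ y # ys) = entries P (xs @ [y]) + entries P (y # ys)"
proof (induction xs)
  case (Cons x xs)
  then show ?case by (cases xs) auto
qed simp

lemma entries_map: "entries P (map g xs) = entries (\<lambda>x. P (g x)) xs"
proof (induction xs)
  case (Cons x xs)
  then show ?case by (cases xs) auto
qed simp

lemma visits_map: "xs \<noteq> [] \<Longrightarrow> visits P (map g xs) = visits (\<lambda>x. P (g x)) xs"
  by (simp add: visits_def entries_map hd_map)

lemma visits_Cons_Cons: "visits P (x # y # xs) = visits P (y # xs) + (if P x \<and> \<not> P y then 1 else 0)"
  by (auto simp: visits_def)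

lemma visits_cong:
  assumes "xs \<noteq> []" "\<And>x. x \<in> set xs \<Longrightarrow> P x = Q x"
  shows "visits P xs = visits Q xs"
proof -
  have "map P xs = map Q xs" using assms(2) by simp
  then have "visits id (map P xs) = visits id (map Q xs)" by (rule arg_cong)
  then show ?thesis unfolding visits_map[OF assms(1)] by simp
qed

text \<open>Runs, unlike entries, do not depend on the direction of reading. This lets the way back
  reuse the counts of the forward walk.\<close>

lemma visits_rev: "visits P (rev xs) = visits P xs"
proof (induction xs)
  case (Cons x xs)
  show ?case
  proof (cases xs)
    case (Cons y ys)
    have "entries P (rev (x # y # ys)) = entries P (rev (y # ys)) + (if \<not> P y \<and> P x then 1 else 0)"
      using entries_split[of P "rev ys" y "[x]"] by simp
    moreover have "hd (rev (x # y # ys)) = hd (rev (y # ys))" by (simp add: hd_append)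
    ultimately have "visits P (rev (x # y # ys)) = visits P (rev (y # ys)) + (if \<not> P y \<and> P x then 1 else 0)"
      unfolding visits_def by simp
    then show ?thesis using Cons.IH Cons by (simp add: visits_Cons_Cons)
  qed simp
qed simp

lemma visits_eq_0_iff: "xs \<noteq> [] \<Longrightarrow> visits P xs = 0 \<longleftrightarrow> (\<forall>x\<in>set xs. \<not> P x)"
proof (induction xs)
  case (Cons x xs)
  then show ?case by (cases xs) (simp_all add: visits_def)
qed simp

lemma entries_mono:
  assumes "sorted_wrt (\<lambda>x y. P x \<longrightarrow> P y) xs" "xs \<noteq> []"
  shows "entries P xs = (if \<not> P (hd xs) \<and> P (last xs) then 1 else 0)"
  using assms
proof (induction xs)
  case (Cons x xs)
  show ?case
  proof (cases xs)
    case (Cons y ys)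
    have "P x \<longrightarrow> P y" using Cons.prems(1) unfolding Cons sorted_wrt.simps list.set by blast
    moreover have "P y \<longrightarrow> P (last (y # ys))"
    proof (cases "ys = []")
      case False
      have "\<forall>z\<in>set ys. P y \<longrightarrow> P z" using Cons.prems(1) unfolding Cons sorted_wrt.simps by blast
      then show ?thesis using last_in_set[OF False] False by simp
    qed simp
    moreover have "sorted_wrt (\<lambda>x y. P x \<longrightarrow> P y) (y # ys)"
      using Cons.prems(1) unfolding Cons sorted_wrt.simps(2)[of _ x] by (rule conjunct2)
    then have "entries P (y # ys) = (if \<not> P y \<and> P (last (y # ys)) then 1 else 0)"
      using Cons.IH[unfolded Cons] unfolding list.sel by blast
    ultimately show ?thesis unfolding Cons entries.simps by simp
  qed simp
qed simp

lemma entries_antimono: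
  assumes "sorted_wrt (\<lambda>x y. P y \<longrightarrow> P x) xs"
  shows "entries P xs = 0"
  using assms
proof (induction xs)
  case (Cons x xs)
  show ?case
  proof (cases xs)
    case (Cons y ys)
    have "P y \<longrightarrow> P x" using Cons.prems unfolding Cons sorted_wrt.simps list.set by blast
    moreover have "entries P (y # ys) = 0" using Cons.IH Cons.prems unfolding Cons sorted_wrt.simps(2)[of _ x] by blast
    ultimately show ?thesis unfolding Cons entries.simps by auto
  qed simp
qed simp

lemma entries_const: "(\<And>x y. x \<in> set xs \<Longrightarrow> y \<in> set xs \<Longrightarrow> P x = P y) \<Longrightarrow> entries P xs = 0"
proof (induction xs)
  case (Cons x xs)
  then show ?case by (cases xs) auto
qed simp

text \<open>Compared step by step, the two sides disagree only at a direct jump from one set outside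
  the other into the other outside the first, which the assumption excludes.\<close>

lemma entries_Un_Int:
  assumes "successively (\<lambda>x y. \<not> (A x \<and> \<not> B x \<and> B y \<and> \<not> A y) \<and> \<not> (B x \<and> \<not> A x \<and> A y \<and> \<not> B y)) xs"
  shows "entries A xs + entries B xs = entries (\<lambda>x. A x \<or> B x) xs + entries (\<lambda>x. A x \<and> B x) xs"
  using assms
proof (induction xs)
  case (Cons x xs)
  then show ?case by (cases xs) auto
qed simp

lemma entries_eq_card:
  "entries P xs = card {t. Suc t < length xs \<and> \<not> P (xs ! t) \<and> P (xs ! Suc t)}"
proof (induction P xs rule: entries.induct)
  case (1 P x y xs)
  let ?S = "{t. Suc t < length (y # xs) \<and> \<not> P ((y # xs) ! t) \<and> P ((y # xs) ! Suc t)}"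
  have "{t. Suc t < length (x # y # xs) \<and> \<not> P ((x # y # xs) ! t) \<and> P ((x # y # xs) ! Suc t)}
    = (if \<not> P x \<and> P y then {0} else {}) \<union> Suc ` ?S" (is "?L = ?R")
  proof (rule set_eqI)
    fix t show "t \<in> ?L \<longleftrightarrow> t \<in> ?R" by (cases t) auto
  qed
  moreover have "finite ?S" by (rule finite_subset[of _ "{..<length (y # xs)}"]) auto
  ultimately show ?case using 1 by (auto simp: card_image)
qed auto

section \<open>Flags with a wire\<close>

type_synonym state = "(nat \<Rightarrow> word) \<times> nat"

definition step :: "nat \<Rightarrow> state \<Rightarrow> state \<Rightarrow> bool" where
  "step n s s' \<longleftrightarrow> (fst s = fst s' \<and> (snd s' = Suc (snd s) \<or> snd s = Suc (snd s'))) \<or>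
     (snd s = snd s' \<and> (\<exists>i<n. i \<noteq> snd s \<and> (\<forall>j. j \<noteq> i \<longrightarrow> fst s j = fst s' j)))"

text \<open>
  In a state \<open>(f, p)\<close> the wire sits in the face \<open>f p\<close>. The last condition says that one
  gets from the last flag back to the first by flipping the levels \<open>n - 1, \<dots>, 0\<close> in turn.
\<close>

definition strip_walk :: "nat \<Rightarrow> state list \<Rightarrow> bool" where
  "strip_walk n xs \<longleftrightarrow> xs \<noteq> [] \<and> successively (step n) xs \<and>
     (\<forall>s\<in>set xs. is_flag n (fst s) \<and> snd s \<le> n) \<and> snd (hd xs) = 0 \<and> snd (last xs) = 0 \<and>
     (\<forall>w. length w = n \<longrightarrow> visits (\<lambda>s. fst s (stars w) = w) xs = 1 \<and>
        visits (\<lambda>s. fst s (snd s) = w) xs = 1) \<and>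
     (\<forall>k<n. word_le (fst (last xs) k) (fst (hd xs) (Suc k)) \<and> fst (last xs) k \<noteq> fst (hd xs) k)"

section \<open>Lifting a walk to the next cube\<close>

definition ins :: "bool \<Rightarrow> (nat \<Rightarrow> word) \<Rightarrow> nat \<Rightarrow> nat \<Rightarrow> word" where
  "ins e f p r = (if r \<le> p then Some e # f r else None # f (r - 1))"

lemma is_flag_ins: "is_flag n f \<Longrightarrow> p \<le> n \<Longrightarrow> is_flag (Suc n) (ins e f p)"
  unfolding is_flag_def
proof (intro conjI allI impI)
  assume f: "(\<forall>r\<le>n. length (f r) = n \<and> stars (f r) = r) \<and> (\<forall>r<n. word_le (f r) (f (Suc r)))" and p: "p \<le> n"
  fix r
  show "length (ins e f p r) = Suc n" "stars (ins e f p r) = r" if "r \<le> Suc n"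
    using f p that by (cases r; simp add: ins_def)+
  show "word_le (ins e f p r) (ins e f p (Suc r))" if "r < Suc n"
    using f p that by (cases r) (auto simp: ins_def)
qed

text \<open>The new wire stays beside the old one, in \<open>F\<^sub>p \<times> 0\<close> or, for
  true \<open>b\<close>, in \<open>F\<^sub>p \<times> [0,1]\<close>.\<close>

definition lift_state :: "state \<Rightarrow> bool \<Rightarrow> state" where
  "lift_state s b = (ins False (fst s) (snd s), snd s + of_bool b)"

text \<open>
  When the old wire moves, the order of its move and of that of the new wire is chosen such that the
  new wire is never on the level at which the old one flips the new flag.
\<close>

definition mid_state :: "state \<Rightarrow> state \<Rightarrow> bool \<Rightarrow> state" where
  "mid_state s s' b = (if (snd s < snd s') = b then (ins False (fst s) (snd s), snd s' + of_bool b)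
     else (ins False (fst s) (snd s'), snd s + of_bool b))"

text \<open>Toggling \<open>b\<close> after each move of the old wire takes the new one across,
  between the faces \<open>w \<times> 0\<close> and \<open>w \<times> [0,1]\<close>, once for each
  face \<open>w\<close> that the old wire reaches.\<close>

fun zigzag :: "bool \<Rightarrow> state list \<Rightarrow> state list" where
  "zigzag b (s # s' # xs) = (if snd s = snd s' then lift_state s b # zigzag b (s' # xs)
     else lift_state s b # mid_state s s' b # lift_state s' b # zigzag (\<not> b) (s' # xs))"
| "zigzag b [s] = [lift_state s b]"
| "zigzag b [] = []"

lemma zigzag_ne: "xs \<noteq> [] \<Longrightarrow> zigzag b xs \<noteq> []"
  by (cases "(b, xs)" rule: zigzag.cases) auto

lemma hd_zigzag: "hd (zigzag b (s # xs)) = lift_state s b"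
  by (cases xs) auto

lemma zigzag_Cons: "\<exists>zs. zigzag b (s # xs) = lift_state s b # zs"
  by (cases xs) auto

text \<open>\<open>b\<close> is toggled at every move of the old wire, and every move changes the
  parity of its level. A wire that starts and ends at level 0 thus leaves \<open>b\<close> as it
  was.\<close>

lemma last_zigzag:
  assumes "successively (step n) xs" "xs \<noteq> []"
  shows "last (zigzag b xs) = lift_state (last xs) (b = (even (snd (hd xs)) = even (snd (last xs))))"
  using assms
proof (induction b xs rule: zigzag.induct)
  case (1 b s s' xs)
  have "step n s s'" using 1 by simp
  then have "snd s \<noteq> snd s' \<Longrightarrow> even (snd s) = odd (snd s')" unfolding step_def by auto
  then show ?case using 1 by (cases b) (auto simp: zigzag_ne)
qed auto

text \<open>A flip below the old wire keeps its level, a flip above it is raised by one. Neither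
  lands on \<open>snd s\<close> or \<open>Suc (snd s)\<close>, the two places open to the new
  wire.\<close>

lemma step_ins:
  assumes "step n s s'" "snd s = snd s'" "q = snd s \<or> q = Suc (snd s)"
  shows "step (Suc n) (ins e (fst s) (snd s), q) (ins e (fst s') (snd s'), q)"
proof -
  obtain i where i: "i < n" "i \<noteq> snd s" "\<And>j. j \<noteq> i \<Longrightarrow> fst s j = fst s' j"
    using assms(1,2) unfolding step_def by auto
  let ?i = "if i < snd s then i else Suc i"
  have "ins e (fst s) (snd s) j = ins e (fst s') (snd s') j" if "j \<noteq> ?i" for j
    using i(1,2) that assms(2) by (auto simp: ins_def intro!: i(3) split: if_splits)
  moreover have "?i < Suc n" "?i \<noteq> q" using i assms(3) by auto
  ultimately show ?thesis unfolding step_def by fastforce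
qed

text \<open>The lifted flags for wire positions \<open>p\<close> and \<open>Suc p\<close> differ at
  level \<open>Suc p\<close> alone, where one has \<open>None # f p\<close> and the other
  \<open>Some e # f (Suc p)\<close>.\<close>

lemma step_ins_move:
  assumes "fst s = fst s'" "snd s' = Suc (snd s) \<or> snd s = Suc (snd s')" "snd s \<le> n" "snd s' \<le> n"
    "q \<noteq> max (snd s) (snd s')"
  shows "step (Suc n) (ins e (fst s) (snd s), q) (ins e (fst s') (snd s'), q)"
proof -
  have "ins e (fst s) (snd s) j = ins e (fst s') (snd s') j" if "j \<noteq> max (snd s) (snd s')" for j
    using assms(1,2) that by (auto simp: ins_def)
  then show ?thesis using assms unfolding step_def by (auto intro!: exI[of _ "max (snd s) (snd s')"])
qed

lemma successively_zigzag:
  assumes "successively (step n) xs" "\<forall>s\<in>set xs. snd s \<le> n"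
  shows "successively (step (Suc n)) (zigzag b xs)"
  using assms
proof (induction b xs rule: zigzag.induct)
  case (1 b s s' xs)
  have st: "step n s s'" using 1 by simp
  obtain zs zs' where z: "zigzag b (s' # xs) = lift_state s' b # zs"
    and z': "zigzag (\<not> b) (s' # xs) = lift_state s' (\<not> b) # zs'" using zigzag_Cons by blast
  show ?case
  proof (cases "snd s = snd s'")
    case True
    have "step (Suc n) (lift_state s b) (lift_state s' b)"
      using step_ins[OF st True] True unfolding lift_state_def by auto
    then show ?thesis using 1 True z by simp
  next
    case False
    then have mv: "fst s = fst s'" "snd s' = Suc (snd s) \<or> snd s = Suc (snd s')"
      using st unfolding step_def by auto
    have le: "snd s \<le> n" "snd s' \<le> n" using 1 by auto
    note m = step_ins_move[OF mv le]
    have a: "step (Suc n) (lift_state s b) (mid_state s s' b)"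
    proof (cases "(snd s < snd s') = b")
      case True
      then show ?thesis using mv unfolding lift_state_def mid_state_def step_def by auto
    next
      case False
      then show ?thesis using mv m[of "snd s + of_bool b" False] unfolding lift_state_def mid_state_def by auto
    qed
    have b: "step (Suc n) (mid_state s s' b) (lift_state s' b)"
    proof (cases "(snd s < snd s') = b")
      case True
      then show ?thesis using mv m[of "snd s' + of_bool b" False] unfolding lift_state_def mid_state_def by auto
    next
      case False
      then show ?thesis using mv unfolding lift_state_def mid_state_def step_def by auto
    qed
    have c: "step (Suc n) (lift_state s' b) (lift_state s' (\<not> b))"
      unfolding lift_state_def step_def by (cases b) auto
    show ?thesis using 1 False z' a b c by simp
  qed
qed auto

lemma is_flag_zigzag:
  assumes "successively (step n) xs" "\<forall>s\<in>set xs. is_flag n (fst s) \<and> snd s \<le> n" "z \<in> set (zigzag b xs)"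
  shows "is_flag (Suc n) (fst z) \<and> snd z \<le> Suc n"
  using assms
proof (induction b xs rule: zigzag.induct)
  case (1 b s s' xs)
  have "is_flag (Suc n) (fst (lift_state t b)) \<and> snd (lift_state t b) \<le> Suc n" if "t \<in> {s, s'}" for t b
    using 1(4) that by (auto simp: lift_state_def is_flag_ins)
  from this[of s b] this[of s' b]
  have l: "is_flag (Suc n) (fst (lift_state s b)) \<and> snd (lift_state s b) \<le> Suc n"
    "is_flag (Suc n) (fst (lift_state s' b)) \<and> snd (lift_state s' b) \<le> Suc n" by auto
  have m: "is_flag (Suc n) (fst (mid_state s s' b)) \<and> snd (mid_state s s' b) \<le> Suc n"
    using 1(4) by (auto simp: mid_state_def is_flag_ins)
  show ?case using 1 l m by (auto split: if_splits)
qed (auto simp: lift_state_def is_flag_ins)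

text \<open>The flags along the zigzag are those lifted from \<open>xs\<close>, some of them
  repeated in succession, and repetitions create no entries.\<close>

lemma entries_zigzag_flag:
  assumes "successively (step n) xs"
  shows "entries (\<lambda>s. Q (fst s)) (zigzag b xs) = entries (\<lambda>s. Q (ins False (fst s) (snd s))) xs"
  using assms
proof (induction b xs rule: zigzag.induct)
  case (1 b s s' xs)
  have st: "step n s s'" using 1 by simp
  obtain zs zs' where z: "zigzag b (s' # xs) = lift_state s' b # zs"
    and z': "zigzag (\<not> b) (s' # xs) = lift_state s' (\<not> b) # zs'" using zigzag_Cons by blast
  show ?case
  proof (cases "snd s = snd s'")
    case True
    then show ?thesis using 1 z by (simp add: lift_state_def)
  next
    case False
    then have "fst s = fst s'" using st unfolding step_def by auto
    then show ?thesis using 1 z' False by (simp add: lift_state_def mid_state_def)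
  qed
qed auto

lemma wire_lift_state: "ins False (fst s) (snd s) (snd s + of_bool b) =
    (if b then None # fst s (snd s) else Some False # fst s (snd s))"
  by (simp add: ins_def)

lemma wire_mid_state:
  assumes "fst s = fst s'" "snd s' = Suc (snd s) \<or> snd s = Suc (snd s')"
  shows "fst (mid_state s s' b) (snd (mid_state s s' b)) =
    (if b then None else Some False) # fst s (snd (if (snd s < snd s') = b then s' else s))"
  using assms by (cases b) (auto simp: ins_def mid_state_def)

text \<open>Each arrival of the old wire in \<open>w\<close> brings the new one into one of the two
  faces over \<open>w\<close>, and the toggle takes it across to the other. Faces before and after a
  move differ because their dimensions do.\<close>

lemma entries_zigzag_wire:
  assumes "successively (step n) xs" "\<forall>s\<in>set xs. is_flag n (fst s) \<and> snd s \<le> n" "c \<noteq> Some True"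
  shows "entries (\<lambda>s. fst s (snd s) = c # w) (zigzag b xs) = entries (\<lambda>s. fst s (snd s) = w) xs"
  using assms
proof (induction b xs rule: zigzag.induct)
  case (1 b s s' xs)
  have st: "step n s s'" using 1 by simp
  obtain zs zs' where z: "zigzag b (s' # xs) = lift_state s' b # zs"
    and z': "zigzag (\<not> b) (s' # xs) = lift_state s' (\<not> b) # zs'" using zigzag_Cons by blast
  have l: "fst (lift_state t d) (snd (lift_state t d)) = (if d then None else Some False) # fst t (snd t)" for t d
    by (simp add: lift_state_def wire_lift_state)
  show ?case
  proof (cases "snd s = snd s'")
    case True
    then have "fst s (snd s) = fst s' (snd s')" using st unfolding step_def by auto
    then show ?thesis using 1 z True l by simp
  next
    case False
    then have mv: "fst s = fst s'" "snd s' = Suc (snd s) \<or> snd s = Suc (snd s')"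
      using st unfolding step_def by auto
    have "stars (fst s (snd s)) = snd s" "stars (fst s' (snd s')) = snd s'"
      using 1 unfolding is_flag_def by auto
    then have ne: "fst s (snd s) \<noteq> fst s' (snd s')" using False by metis
    have c: "c = None \<or> c = Some False" using 1(5) by (cases c) auto
    have IH: "entries (\<lambda>s. fst s (snd s) = c # w) (lift_state s' (\<not> b) # zs')
        = entries (\<lambda>s. fst s (snd s) = w) (s' # xs)"
      using 1 False z' by simp
    show ?thesis
      using ne c False mv z' IH by (cases b) (auto simp: l wire_mid_state[OF mv])
  qed
qed auto

text \<open>With the old wire at level 0, replacing \<open>False\<close> by \<open>True\<close>
  flips level 0 only, while the new wire waits on level 1. It then drops to level 0 and stays there
  while the old wire rises, since each rise flips a level above 0. On the way back the old wire
  remains at \<open>n\<close>, and the new one goes where the old one went.\<close>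

definition extend :: "nat \<Rightarrow> state list \<Rightarrow> state list" where
  "extend n xs = (lift_state (hd xs) False # zigzag True xs) @ (ins True (fst (last xs)) 0, 1) #
     map (\<lambda>p. (ins True (fst (last xs)) p, 0)) [0..<n] @ map (\<lambda>s. (ins True (fst s) n, snd s)) (rev xs)"

text \<open>
  The two sets have union \<open>{s. fst s (stars w) = w}\<close> and intersection \<open>{s. fst s (snd s) = w}\<close>,
  both visited once; since the wire moves by single steps, the numbers of visits satisfy
  inclusion-exclusion.
\<close>

lemma visits_above_below:
  assumes W: "strip_walk n xs" and w: "length w = n"
  shows "visits (\<lambda>s. stars w \<le> snd s \<and> fst s (stars w) = w) xs = 1"
    "visits (\<lambda>s. snd s \<le> stars w \<and> fst s (stars w) = w) xs = 1"
proof -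
  let ?A = "\<lambda>s. stars w \<le> snd s \<and> fst s (stars w) = w" and ?B = "\<lambda>s. snd s \<le> stars w \<and> fst s (stars w) = w"
  have ne: "xs \<noteq> []" and fl: "\<forall>s\<in>set xs. is_flag n (fst s) \<and> snd s \<le> n" using W unfolding strip_walk_def by auto
  have "successively (step n) xs" using W unfolding strip_walk_def by simp
  then have "successively (\<lambda>x y. \<not> (?A x \<and> \<not> ?B x \<and> ?B y \<and> \<not> ?A y) \<and> \<not> (?B x \<and> \<not> ?A x \<and> ?A y \<and> \<not> ?B y)) xs"
    by (rule successively_mono) (auto simp: step_def)
  then have "entries ?A xs + entries ?B xs = entries (\<lambda>x. ?A x \<or> ?B x) xs + entries (\<lambda>x. ?A x \<and> ?B x) xs"
    by (rule entries_Un_Int)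
  then have sum: "visits ?A xs + visits ?B xs = visits (\<lambda>x. ?A x \<or> ?B x) xs + visits (\<lambda>x. ?A x \<and> ?B x) xs"
    unfolding visits_def by auto
  have "visits (\<lambda>x. ?A x \<or> ?B x) xs = visits (\<lambda>s. fst s (stars w) = w) xs"
    by (rule arg_cong[where f = "\<lambda>P. visits P xs"]) auto
  moreover have J: "visits (\<lambda>x. ?A x \<and> ?B x) xs = visits (\<lambda>s. fst s (snd s) = w) xs"
  proof -
    have "(?A s \<and> ?B s) = (fst s (snd s) = w)" if "s \<in> set xs" for s
      using fl that unfolding is_flag_def by (metis order_antisym order_refl)
    then show ?thesis by (rule visits_cong[OF ne])
  qed
  ultimately have sum2: "visits ?A xs + visits ?B xs = 2" "visits (\<lambda>x. ?A x \<and> ?B x) xs = 1"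
    using sum W w unfolding strip_walk_def by auto
  \<comment> \<open>Both sets contain the visit of the wire, so each is visited at least once, and
    the visits add up to 2.\<close>
  then have "\<not> (\<forall>s\<in>set xs. \<not> (?A s \<and> ?B s))" using visits_eq_0_iff[OF ne, of "\<lambda>x. ?A x \<and> ?B x"] by linarith
  then have "visits ?A xs \<noteq> 0" "visits ?B xs \<noteq> 0" unfolding visits_eq_0_iff[OF ne] by blast+
  then show "visits ?A xs = 1" "visits ?B xs = 1" using sum2(1) by linarith+
qed

lemma sorted_wrt_Cons_Cons_map_upt:
  assumes "R a b" "\<And>p. p \<le> n \<Longrightarrow> R a (u p)" "\<And>p. p \<le> n \<Longrightarrow> R b (u p)"
    and "\<And>p q. p < q \<Longrightarrow> q \<le> n \<Longrightarrow> R (u p) (u q)"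
  shows "sorted_wrt R (a # b # map u [0..<Suc n])"
proof -
  have "sorted_wrt R (map u [0..<Suc n])"
    by (rule sorted_wrt_map_mono[OF sorted_wrt_upt]) (use assms(4) in auto)
  then show ?thesis using assms(1-3) by (auto simp del: upt_Suc)
qed

section \<open>Verification of the extended walk\<close>

context
  fixes n :: nat and xs :: "state list"
  assumes walk: "strip_walk n xs"
begin

definition start where "start = fst (hd xs)"
definition finish where "finish = fst (last xs)"

definition zig_part where "zig_part = lift_state (hd xs) False # zigzag True xs"
text \<open>Its first state is also the last one of \<open>zig_part\<close> and its last state the
  head of \<open>retreat\<close>, so that every transition between neighbours is counted in exactly
  one of the three pieces.\<close>

definition bridge where "bridge = (ins False finish 0, 1) # (ins True finish 0, 1) # map (\<lambda>p. (ins True finish p, 0::nat)) [0..<Suc n]"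
definition retreat where "retreat = map (\<lambda>s. (ins True (fst s) n, snd s)) (rev xs)"

lemma walk_ne: "xs \<noteq> []" and walk_step: "successively (step n) xs"
  and walk_flag: "\<forall>s\<in>set xs. is_flag n (fst s) \<and> snd s \<le> n"
  and walk_hd: "hd xs = (start, 0)" and walk_last: "last xs = (finish, 0)"
  and walk_visits: "length w = n \<Longrightarrow> visits (\<lambda>s. fst s (stars w) = w) xs = 1 \<and>
        visits (\<lambda>s. fst s (snd s) = w) xs = 1"
  using walk unfolding strip_walk_def start_def finish_def by (auto simp: prod_eq_iff)

lemma flag_start: "is_flag n start" and flag_finish: "is_flag n finish"
  using walk_flag walk_ne walk_hd walk_last hd_in_set last_in_set by (metis fst_conv)+

lemma hd_retreat: "retreat = (ins True finish n, 0) # tl retreat"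
  using walk_last walk_ne unfolding retreat_def by (cases xs rule: rev_cases) auto

lemma last_zig_part: "last zig_part = (ins False finish 0, 1)"
  using last_zigzag[OF walk_step walk_ne, of True] zigzag_ne[OF walk_ne, of True] walk_hd walk_last
  unfolding zig_part_def by (simp add: lift_state_def)

lemma extend_eq: "extend n xs = butlast zig_part @ (ins False finish 0, 1) # (ins True finish 0, 1) #
    map (\<lambda>p. (ins True finish p, 0)) [0..<n] @ retreat"
proof -
  have "zig_part = butlast zig_part @ [(ins False finish 0, 1)]"
    using last_zig_part append_butlast_last_id[of zig_part] unfolding zig_part_def by simp
  then show ?thesis unfolding extend_def zig_part_def[symmetric] finish_def[symmetric] retreat_def[symmetric]
    by (metis append.assoc append_Cons append_Nil)
qed

lemma visits_extend: "visits P (extend n xs) = visits P zig_part + entries P bridge + entries P retreat"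
proof -
  have z: "zig_part = butlast zig_part @ [(ins False finish 0, 1)]"
    using last_zig_part append_butlast_last_id[of zig_part] unfolding zig_part_def by simp
  have "hd (extend n xs) = hd zig_part" unfolding extend_def zig_part_def by simp
  moreover have "entries P (extend n xs) = entries P zig_part + (entries P bridge + entries P retreat)"
  proof -
    let ?m = "map (\<lambda>p. (ins True finish p, 0::nat)) [0..<n]"
    have "entries P (extend n xs) = entries P zig_part +
        entries P ((ins False finish 0, 1) # (ins True finish 0, 1) # ?m @ retreat)"
      unfolding extend_eq by (subst entries_split) (simp only: z[symmetric])
    also have "(ins False finish 0, 1) # (ins True finish 0, 1) # ?m @ retreat =
        ((ins False finish 0, 1) # (ins True finish 0, 1) # ?m) @ (ins True finish n, 0) # tl retreat"
      using hd_retreat by simp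
    also have "entries P \<dots> = entries P bridge + entries P retreat"
      unfolding entries_split[of _ _ "(ins True finish n, 0)" "tl retreat"]
      unfolding hd_retreat[symmetric] bridge_def
      by (simp only: upt_Suc_append map_append append_Cons list.map le0)
    finally show ?thesis by (simp only:)
  qed
  ultimately show ?thesis unfolding visits_def by simp
qed

lemma entries_bridge_mono:
  assumes "P (ins False finish 0, 1) \<Longrightarrow> P (ins True finish 0, 1)" "\<And>p. P (ins True finish 0, 1) \<Longrightarrow> P (ins True finish p, 0)"
    "\<And>p q. p < q \<Longrightarrow> P (ins True finish p, 0) \<Longrightarrow> P (ins True finish q, 0)"
  shows "entries P bridge = (if \<not> P (ins False finish 0, 1) \<and> P (ins True finish n, 0) then 1 else 0)"
proof -
  have "entries P bridge = (if \<not> P (hd bridge) \<and> P (last bridge) then 1 else 0)"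
    by (rule entries_mono, unfold bridge_def, rule sorted_wrt_Cons_Cons_map_upt) (use assms in auto)
  then show ?thesis by (simp add: bridge_def)
qed

lemma entries_bridge_antimono:
  assumes "P (ins True finish 0, 1) \<Longrightarrow> P (ins False finish 0, 1)" "\<And>p. p \<le> n \<Longrightarrow> P (ins True finish p, 0) \<Longrightarrow> P (ins True finish 0, 1)"
    "\<And>p q. p < q \<Longrightarrow> q \<le> n \<Longrightarrow> P (ins True finish q, 0) \<Longrightarrow> P (ins True finish p, 0)"
  shows "entries P bridge = 0"
  unfolding bridge_def
  by (rule entries_antimono, rule sorted_wrt_Cons_Cons_map_upt) (use assms in auto)

lemma zigzag_no_True: "z \<in> set (zigzag b ys) \<Longrightarrow> fst z r \<noteq> Some True # w"
  by (induction b ys rule: zigzag.induct) (auto simp: lift_state_def mid_state_def ins_def split: if_splits)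

lemma visits_zig_part_True: "visits (\<lambda>s. fst s (q s) = Some True # w) zig_part = 0"
proof -
  have "fst z (q z) \<noteq> Some True # w" if "z \<in> set zig_part" for z
    using that zigzag_no_True[of z True xs] unfolding zig_part_def by (auto simp: lift_state_def ins_def split: if_splits)
  then show ?thesis by (subst visits_eq_0_iff) (auto simp: zig_part_def)
qed

lemma visits_zig_part_flag: "visits (\<lambda>s. Q (fst s)) zig_part = visits (\<lambda>s. Q (ins False (fst s) (snd s))) xs"
proof -
  obtain zs where "zigzag True xs = lift_state (hd xs) True # zs"
    using zigzag_Cons walk_ne by (metis list.collapse)
  then show ?thesis
    using entries_zigzag_flag[OF walk_step, of Q True] unfolding visits_def zig_part_def
    by (simp add: lift_state_def)
qed

lemma visits_zig_part_wire:
  assumes "c \<noteq> Some True" "length w = n"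
  shows "visits (\<lambda>s. fst s (snd s) = c # w) zig_part = 1"
proof -
  obtain zs where z: "zigzag True xs = lift_state (hd xs) True # zs"
    using zigzag_Cons walk_ne by (metis list.collapse)
  have c: "c = None \<or> c = Some False" using assms(1) by (cases c) auto
  have "visits (\<lambda>s. fst s (snd s) = c # w) zig_part = (if start 0 = w then 1 else 0) + entries (\<lambda>s. fst s (snd s) = c # w) (zigzag True xs)"
    using c unfolding visits_def zig_part_def z by (auto simp: lift_state_def ins_def walk_hd)
  also have "\<dots> = visits (\<lambda>s. fst s (snd s) = w) xs"
    unfolding entries_zigzag_wire[OF walk_step walk_flag assms(1)] visits_def by (simp add: walk_hd)
  finally show ?thesis using walk_visits[OF assms(2)] by simp
qed

lemma top_eq: "is_flag n f \<Longrightarrow> f n = replicate n None"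
  unfolding is_flag_def using stars_eq_length_iff[of "f n"] by simp

text \<open>Reversal preserves visits but not entries. The entries are recovered as the visits less
  a run that is already under way at the head.\<close>

lemma entries_retreat: "entries P retreat = visits (\<lambda>s. P (ins True (fst s) n, snd s)) xs - (if P (ins True finish n, 0) then 1 else 0)"
proof -
  have "visits P retreat = visits (\<lambda>s. P (ins True (fst s) n, snd s)) xs"
    unfolding retreat_def using walk_ne by (simp add: visits_map visits_rev)
  moreover have "hd retreat = (ins True finish n, 0)" using hd_retreat by (metis list.sel(1))
  ultimately show ?thesis unfolding visits_def[of P retreat] by simp
qed

text \<open>\<open>w \<times> 0\<close> is in the flag while the wire is at or above level
  \<open>stars w\<close>, and \<open>w \<times> [0,1]\<close> while it is at or below, so
  \<open>visits_above_below\<close> counts both during the zigzag. \<open>w \<times> 1\<close> is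
  met only afterwards: the bridge enters it if \<open>w\<close> belongs to \<open>finish\<close>,
  the way back otherwise.\<close>

lemma visits_extend_flag:
  assumes "length w' = Suc n"
  shows "visits (\<lambda>s. fst s (stars w') = w') (extend n xs) = 1" (is "visits ?P _ = 1")
proof -
  obtain c w where w': "w' = c # w" and w: "length w = n" using assms by (cases w') auto
  have sw: "stars w \<le> n" using stars_le_length[of w] w by simp
  consider "c = Some False" | "c = None" | "c = Some True" by (cases c) auto
  then show ?thesis
  proof cases
    case 1
    have "visits ?P zig_part = visits (\<lambda>s. stars w \<le> snd s \<and> fst s (stars w) = w) xs"
      unfolding visits_zig_part_flag[of "\<lambda>f. f (stars w') = w'"]
      by (rule arg_cong[where f = "\<lambda>P. visits P xs"]) (auto simp: w' 1 ins_def)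
    then have "visits ?P zig_part = 1" using visits_above_below(1)[OF walk w] by simp
    moreover have "entries ?P bridge = 0"
      by (rule entries_bridge_antimono) (auto simp: w' 1 ins_def split: if_splits)
    moreover have "entries ?P retreat = 0"
      by (rule entries_const) (auto simp: retreat_def w' 1 ins_def split: if_splits)
    ultimately show ?thesis by (simp add: visits_extend)
  next
    case 2
    have "visits ?P zig_part = visits (\<lambda>s. snd s \<le> stars w \<and> fst s (stars w) = w) xs"
      unfolding visits_zig_part_flag[of "\<lambda>f. f (stars w') = w'"]
      by (rule arg_cong[where f = "\<lambda>P. visits P xs"]) (auto simp: w' 2 ins_def)
    then have "visits ?P zig_part = 1" using visits_above_below(2)[OF walk w] by simp
    moreover have "entries ?P bridge = 0"
      by (rule entries_bridge_antimono) (auto simp: w' 2 ins_def split: if_splits)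
    \<comment> \<open>On the way back only level \<open>Suc n\<close> has a free first coordinate,
      and it always holds the whole cube.\<close>
    moreover have "entries ?P retreat = 0"
    proof (rule entries_const)
      fix x y assume "x \<in> set retreat" "y \<in> set retreat"
      then obtain s t where "s \<in> set xs" "t \<in> set xs" and x: "fst x = ins True (fst s) n" and y: "fst y = ins True (fst t) n"
        unfolding retreat_def by auto
      then have "fst s n = fst t n" using walk_flag top_eq by metis
      then show "?P x = ?P y" using sw unfolding x y by (cases "stars w = n") (auto simp: w' 2 ins_def)
    qed
    ultimately show ?thesis by (simp add: visits_extend)
  next
    case 3
    have "visits ?P zig_part = 0" unfolding w' 3 by (rule visits_zig_part_True)
    moreover have "entries ?P bridge = (if finish (stars w) = w then 1 else 0)"
      using sw by (subst entries_bridge_mono) (auto simp: w' 3 ins_def split: if_splits)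
    moreover have "entries ?P retreat = 1 - (if finish (stars w) = w then 1 else 0)"
      unfolding entries_retreat using sw walk_visits[OF w] by (simp add: w' 3 ins_def)
    ultimately show ?thesis by (simp add: visits_extend)
  qed
qed

lemma visits_extend_wire:
  assumes "length w' = Suc n"
  shows "visits (\<lambda>s. fst s (snd s) = w') (extend n xs) = 1" (is "visits ?P _ = 1")
proof -
  obtain c w where w': "w' = c # w" and w: "length w = n" using assms by (cases w') auto
  have retreat: "visits (\<lambda>s. ?P (ins True (fst s) n, snd s)) xs = visits (\<lambda>s. c = Some True \<and> fst s (snd s) = w) xs"
    by (rule visits_cong[OF walk_ne]) (use walk_flag in \<open>auto simp: w' ins_def\<close>)
  show ?thesis
  proof (cases "c = Some True")
    case False
    then have "visits ?P zig_part = 1" unfolding w' using w by (rule visits_zig_part_wire)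
    moreover have "entries ?P bridge = 0"
      by (rule entries_bridge_antimono) (use False in \<open>auto simp: w' ins_def split: if_splits\<close>)
    moreover have "entries ?P retreat = 0"
    proof -
      have "visits (\<lambda>s. False) xs = 0" using walk_ne by (simp add: visits_eq_0_iff)
      then show ?thesis unfolding entries_retreat retreat using False by simp
    qed
    ultimately show ?thesis by (simp add: visits_extend)
  next
    case True
    have "visits ?P zig_part = 0" unfolding w' True by (rule visits_zig_part_True)
    moreover have "entries ?P bridge = (if finish 0 = w then 1 else 0)"
      by (subst entries_bridge_mono) (auto simp: w' True ins_def split: if_splits)
    moreover have "entries ?P retreat = 1 - (if finish 0 = w then 1 else 0)"
      unfolding entries_retreat retreat using walk_visits[OF w] True by (simp add: w' ins_def)
    ultimately show ?thesis by (simp add: visits_extend)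
  qed
qed

lemma successively_extend: "successively (step (Suc n)) (extend n xs)"
proof -
  have zig_part: "successively (step (Suc n)) zig_part"
  proof -
    have "successively (step (Suc n)) (zigzag True xs)"
      using successively_zigzag[OF walk_step] walk_flag by blast
    moreover have "step (Suc n) (lift_state (hd xs) False) (lift_state (hd xs) True)"
      by (auto simp: lift_state_def step_def)
    moreover have "hd (zigzag True xs) = lift_state (hd xs) True"
      using hd_zigzag walk_ne by (metis list.collapse)
    ultimately show ?thesis unfolding zig_part_def by (simp add: successively_Cons)
  qed
  have u: "step (Suc n) (ins True finish p, 0) (ins True finish (Suc p), 0)" if "p < n" for p
    using step_ins_move[of "(finish, p)" "(finish, Suc p)" n 0 True] that by simp
  have retreat: "successively (step (Suc n)) retreat"
    unfolding retreat_def successively_map successively_rev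
  proof (rule successively_mono[OF walk_step])
    fix s t assume st: "s \<in> set xs" "t \<in> set xs" "step n s t"
    show "step (Suc n) (ins True (fst t) n, snd t) (ins True (fst s) n, snd s)"
    proof (cases "snd s = snd t")
      case True
      then obtain i where i: "i < n" "i \<noteq> snd t" "\<And>j. j \<noteq> i \<Longrightarrow> fst s j = fst t j"
        using st(3) unfolding step_def by auto
      have "ins True (fst t) n j = ins True (fst s) n j" if "j \<noteq> i" for j
        using i(1,3) that top_eq[of "fst s"] by (cases "j = Suc n") (auto simp: ins_def)
      then show ?thesis using i(1,2) True unfolding step_def by (auto intro!: exI[of _ i])
    next
      case False
      then show ?thesis using st(3) unfolding step_def by auto
    qed
  qed
  have ups: "successively (step (Suc n)) (map (\<lambda>p. (ins True finish p, 0)) [0..<n])"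
    unfolding successively_conv_nth using u by simp
  have ex: "extend n xs = zig_part @ (ins True finish 0, 1) # map (\<lambda>p. (ins True finish p, 0)) [0..<n] @ retreat"
    unfolding extend_def zig_part_def retreat_def finish_def by simp
  have ct: "step (Suc n) (last zig_part) (ins True finish 0, 1)"
    unfolding last_zig_part step_def by (auto simp: ins_def intro!: exI[of _ 0])
  have hb: "hd retreat = (ins True finish n, 0)" and bne: "retreat \<noteq> []" using hd_retreat by (metis list.sel(1), metis list.distinct(1))
  have d: "step (Suc n) (ins True finish 0, 1) (ins True finish 0, 0)" unfolding step_def by auto
  show ?thesis
  proof (cases n)
    case 0
    then show ?thesis unfolding ex
      using zig_part retreat ct d hb bne by (simp add: successively_append_iff successively_Cons)
  next
    case (Suc k)
    have l: "last (map (\<lambda>p. (ins True finish p, 0::nat)) [0..<n]) = (ins True finish k, 0)" using Suc by simp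
    have h: "hd (map (\<lambda>p. (ins True finish p, 0::nat)) [0..<n] @ retreat) = (ins True finish 0, 0)" using Suc by (simp add: upt_conv_Cons del: upt_Suc)
    have "step (Suc n) (ins True finish k, 0) (ins True finish n, 0)" using u[of k] Suc by simp
    then show ?thesis unfolding ex
      using zig_part retreat ct d hb bne ups l h Suc
      by (simp add: successively_append_iff successively_Cons del: upt_Suc)
  qed
qed

lemma strip_walk_extend: "strip_walk (Suc n) (extend n xs)"
proof -
  have hd: "hd (extend n xs) = (ins False start 0, 0)" unfolding extend_def by (simp add: lift_state_def walk_hd)
  have "last retreat = (ins True start n, 0)"
    unfolding retreat_def using walk_ne walk_hd by (simp add: last_map last_rev)
  moreover have "retreat \<noteq> []" using walk_ne unfolding retreat_def by simp
  ultimately have last: "last (extend n xs) = (ins True start n, 0)"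
    unfolding extend_eq by simp
  have "is_flag (Suc n) (fst z) \<and> snd z \<le> Suc n" if "z \<in> set (extend n xs)" for z
  proof -
    have "z \<in> set zig_part \<or> z \<in> insert (ins True finish 0, 1) ((\<lambda>p. (ins True finish p, 0)) ` {0..<n}) \<or> z \<in> set retreat"
      using that unfolding extend_def zig_part_def retreat_def finish_def by auto
    then show ?thesis
    proof (elim disjE)
      assume "z \<in> set zig_part"
      then consider "z = (ins False start 0, 0)" | "z \<in> set (zigzag True xs)"
        unfolding zig_part_def by (auto simp: lift_state_def walk_hd)
      then show ?thesis
      proof cases
        case 2
        then show ?thesis using is_flag_zigzag[OF walk_step walk_flag] by blast
      qed (simp add: is_flag_ins flag_start)
    next
      assume "z \<in> set retreat"
      then show ?thesis using walk_flag is_flag_ins unfolding retreat_def by fastforce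
    qed (use is_flag_ins[OF flag_finish] in auto)
  qed
  \<comment> \<open>Both ends are lifted from the same flag: \<open>start k \<times> 1\<close> lies
    in \<open>start k \<times> [0,1]\<close>, which is level \<open>Suc k\<close> of the first
    flag.\<close>
  moreover have "word_le (ins True start n k) (ins False start 0 (Suc k)) \<and> ins True start n k \<noteq> ins False start 0 k" if "k < Suc n" for k
    using that by (auto simp: ins_def)
  ultimately show ?thesis
    unfolding strip_walk_def hd last
    using successively_extend visits_extend_flag visits_extend_wire by (auto simp: extend_def)
qed

end

theorem ex_strip_walk: "\<exists>xs. strip_walk n xs"
proof (induction n)
  case 0
  have "strip_walk 0 [(\<lambda>_. [], 0)]" by (simp add: strip_walk_def is_flag_def visits_def)
  then show ?case ..
next
  case (Suc n)
  then show ?case using strip_walk_extend by blast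
qed

section \<open>Closing the walk\<close>

text \<open>A visit under way at the start of the walk is no entry. The return to the first flag
  supplies exactly the missing entries, so on the closed list visits become entries. The last two
  facts record a flip of level 0 and one of level \<open>n - 1\<close>, to which the re-entries of
  the empty face and of the whole cube will be tied.\<close>

lemma closed_walk:
  assumes n: "0 < n"
  obtains ys k where "Suc k < length ys" "hd ys = last ys"
    "\<And>f. f \<in> set ys \<Longrightarrow> is_flag n f"
    "successively (\<lambda>f g. \<exists>i<n. \<forall>j\<le>n. j \<noteq> i \<longrightarrow> g j = f j) ys"
    "\<And>w. length w = n \<Longrightarrow> stars w < n \<Longrightarrow> entries (\<lambda>f. f (stars w) = w) ys = 1"
    "(ys ! (length ys - 2)) 0 \<noteq> last ys 0" "(ys ! k) (n - 1) \<noteq> (ys ! Suc k) (n - 1)"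
proof -
  obtain xs where W: "strip_walk n xs" using ex_strip_walk by blast
  define S where "S = fst (hd xs)"
  define T where "T = fst (last xs)"
  \<comment> \<open>In \<open>D k\<close> the levels from \<open>k\<close> on have already been
    exchanged. The closing condition of the walk makes this a flag, and \<open>D 0\<close> is the
    first flag again.\<close>
  define D where "D k = (\<lambda>r. if r < k then T r else S r)" for k
  define ys where "ys = map fst xs @ map D (rev [0..<n])"
  have ne: "xs \<noteq> []" and fl: "\<And>s. s \<in> set xs \<Longrightarrow> is_flag n (fst s)"
    and close: "\<And>k. k < n \<Longrightarrow> word_le (T k) (S (Suc k)) \<and> T k \<noteq> S k"
    and st: "successively (step n) xs"
    using W unfolding strip_walk_def S_def T_def by auto
  have flT: "is_flag n T" and flS: "is_flag n S"
    using fl ne unfolding T_def S_def by auto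
  have top: "T n = S n"
    using flT flS stars_eq_length_iff[of "T n"] stars_eq_length_iff[of "S n"] unfolding is_flag_def by simp
  have rev_upt: "rev [0..<n] = (n - 1) # rev [0..<n - 1]"
    using n by (cases n) auto
  have D0: "D 0 = S" unfolding D_def by simp
  show ?thesis
  proof (rule that[of "length xs - 1" ys])
    have lx: "length xs > 0" using ne by simp
    then show "Suc (length xs - 1) < length ys" using n unfolding ys_def by simp
    have last_ys: "last ys = S" using n D0 unfolding ys_def by (simp add: last_map last_rev)
    then show "hd ys = last ys" using ne unfolding ys_def S_def by (simp add: hd_map)
    show "is_flag n f" if "f \<in> set ys" for f
    proof -
      have "is_flag n (D k)" if "k < n" for k
        unfolding is_flag_def
      proof (intro conjI allI impI)
        fix r
        show "length (D k r) = n" "stars (D k r) = r" if "r \<le> n"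
          using flT flS that unfolding is_flag_def D_def by auto
        show "word_le (D k r) (D k (Suc r))" if "r < n"
          using flT flS that close[of r] unfolding is_flag_def D_def by auto
      qed
      then show ?thesis using that fl unfolding ys_def by auto
    qed
    show "successively (\<lambda>f g. \<exists>i<n. \<forall>j\<le>n. j \<noteq> i \<longrightarrow> g j = f j) ys"
    proof -
      let ?R = "\<lambda>f g. \<exists>i<n. \<forall>j\<le>n. j \<noteq> i \<longrightarrow> g j = (f j :: word)"
      have "successively ?R (map fst xs)"
        unfolding successively_map
        by (rule successively_mono[OF st]) (use n in \<open>auto simp: step_def\<close>)
      moreover have "successively ?R (map D (rev [0..<n]))"
        unfolding successively_map successively_rev
        unfolding successively_conv_nth
      proof (intro allI impI)
        fix i assume "Suc i < length [0..<n]"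
        then show "?R (D ([0..<n] ! Suc i)) (D ([0..<n] ! i))"
          by (intro exI[of _ i]) (auto simp: D_def)
      qed
      moreover have "?R T (D (n - 1))"
      proof (intro exI[of _ "n - 1"] conjI allI impI)
        fix j assume "j \<le> n" "j \<noteq> n - 1"
        then have "j < n - 1 \<or> j = n" by linarith
        then show "D (n - 1) j = T j" using top unfolding D_def by auto
      qed (use n in simp)
      ultimately show ?thesis
        using ne unfolding ys_def successively_append_iff rev_upt by (simp add: last_map T_def)
    qed
    show "entries (\<lambda>f. f (stars w) = w) ys = 1" if w: "length w = n" "stars w < n" for w
    proof -
      let ?P = "\<lambda>f. f (stars w) = w"
      have xs: "map fst xs = map fst (butlast xs) @ [T]"
        using ne unfolding T_def by (cases xs rule: rev_cases) auto
      have desc: "sorted_wrt (\<lambda>x y. y < x) (rev [0..<n])"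
        unfolding sorted_wrt_rev by simp
      have "entries ?P ys = entries ?P (map fst xs) + entries ?P (T # map D (rev [0..<n]))"
        unfolding ys_def xs using entries_split[of ?P "map fst (butlast xs)" T "map D (rev [0..<n])"] by simp
      \<comment> \<open>The return enters precisely the proper faces of \<open>S\<close>, the ones
        present at the start.\<close>
      moreover have "entries ?P (T # map D (rev [0..<n])) = (if S (stars w) = w then 1 else 0)"
      proof (cases "S (stars w) = w")
        case True
        then have T: "T (stars w) \<noteq> w" using close w by metis
        have "entries ?P (T # map D (rev [0..<n])) =
          (if \<not> ?P (hd (T # map D (rev [0..<n]))) \<and> ?P (last (T # map D (rev [0..<n]))) then 1 else 0)"
        proof (rule entries_mono)
          have "sorted_wrt (\<lambda>f g. ?P f \<longrightarrow> ?P g) (map D (rev [0..<n]))"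
            by (rule sorted_wrt_map_mono[OF desc]) (use T in \<open>auto simp: D_def\<close>)
          then show "sorted_wrt (\<lambda>f g. ?P f \<longrightarrow> ?P g) (T # map D (rev [0..<n]))"
            using T unfolding sorted_wrt.simps by blast
        qed simp
        moreover have "last (T # map D (rev [0..<n])) = S" using n D0 by (simp add: last_map last_rev)
        ultimately show ?thesis using T True by simp
      next
        case False
        have "sorted_wrt (\<lambda>f g. ?P g \<longrightarrow> ?P f) (map D (rev [0..<n]))"
          by (rule sorted_wrt_map_mono[OF desc]) (use False in \<open>auto simp: D_def\<close>)
        moreover have "?P g \<longrightarrow> ?P T" if "g \<in> set (map D (rev [0..<n]))" for g
          using that False by (auto simp: D_def split: if_splits)
        ultimately have "sorted_wrt (\<lambda>f g. ?P g \<longrightarrow> ?P f) (T # map D (rev [0..<n]))"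
          unfolding sorted_wrt.simps by blast
        then show ?thesis using False by (simp only: entries_antimono if_False)
      qed
      moreover have "visits ?P (map fst xs) = 1"
        using W w ne unfolding strip_walk_def by (simp add: visits_map)
      moreover have "hd (map fst xs) = S" using ne by (simp add: hd_map S_def)
      ultimately show ?thesis unfolding visits_def by simp
    qed
    show "(ys ! (length ys - 2)) 0 \<noteq> last ys 0"
    proof (cases "n = 1")
      case True
      then have "ys ! (length ys - 2) = T"
        using ne lx unfolding ys_def T_def by (simp add: nth_append last_conv_nth)
      then show ?thesis using last_ys close[of 0] n by simp
    next
      case False
      have "[0..<n] = 0 # 1 # [2..<n]" using False n by (simp add: upt_conv_Cons numeral_2_eq_2)
      then have "ys = (map fst xs @ map D (rev [2..<n])) @ [D 1, D 0]" unfolding ys_def by simp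
      then have "ys ! (length ys - 2) = D 1" by (simp add: nth_append)
      then show ?thesis using last_ys close[of 0] n by (simp add: D_def)
    qed
    have "ys ! (length xs - 1) = T" using ne lx unfolding ys_def T_def by (simp add: nth_append last_conv_nth)
    moreover have "ys ! Suc (length xs - 1) = D (n - 1)"
      using lx unfolding ys_def rev_upt by (simp add: nth_append)
    ultimately show "(ys ! (length xs - 1)) (n - 1) \<noteq> (ys ! Suc (length xs - 1)) (n - 1)"
      using close[of "n - 1"] n by (simp add: D_def)
  qed
qed

section \<open>Periodic sequences of flags\<close>

text \<open>Time 0 and time \<open>K\<close> mark a flip of level 0 and a flip of level
  \<open>n - 1\<close>.\<close>

locale cyclic_flags =
  fixes n :: nat and M K :: int and F :: "int \<Rightarrow> nat \<Rightarrow> word"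
  assumes n: "0 < n" and M: "0 < M"
    and flag: "is_flag n (F \<tau>)"
    and periodic: "F (\<tau> + M) = F \<tau>"
    and flip1: "\<exists>i<n. \<forall>j\<le>n. j \<noteq> i \<longrightarrow> F (\<tau> + 1) j = F \<tau> j"
    and enter_ex: "length w = n \<Longrightarrow> stars w < n \<Longrightarrow> \<exists>\<tau>. F (\<tau> - 1) (stars w) \<noteq> w \<and> F \<tau> (stars w) = w"
    and enter_unique: "r < n \<Longrightarrow> F (\<tau> - 1) r \<noteq> F \<tau> r \<Longrightarrow> F (\<sigma> - 1) r \<noteq> F \<sigma> r \<Longrightarrow> F \<tau> r = F \<sigma> r \<Longrightarrow> M dvd \<tau> - \<sigma>"
    and bot: "F (- 1) 0 \<noteq> F 0 0" and top: "F (K - 1) (n - 1) \<noteq> F K (n - 1)"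

lemma ex_cyclic_flags:
  assumes n: "0 < n"
  shows "\<exists>M K F. cyclic_flags n M K F"
proof -
  obtain ys k where k: "Suc k < length ys" and cl: "hd ys = last ys"
    and fl: "\<And>f. f \<in> set ys \<Longrightarrow> is_flag n f"
    and st: "successively (\<lambda>f g. \<exists>i<n. \<forall>j\<le>n. j \<noteq> i \<longrightarrow> g j = f j) ys"
    and en: "\<And>w. length w = n \<Longrightarrow> stars w < n \<Longrightarrow> entries (\<lambda>f. f (stars w) = w) ys = 1"
    and b: "(ys ! (length ys - 2)) 0 \<noteq> last ys 0" and t: "(ys ! k) (n - 1) \<noteq> (ys ! Suc k) (n - 1)"
    by (rule closed_walk[OF n]) (rule that)
  \<comment> \<open>The last flag repeats the first, so the period is one less than the
    length.\<close>
  define m where "m = length ys - 1"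
  have m: "0 < m" "length ys = Suc m" "ys \<noteq> []" using k unfolding m_def by auto
  have wrap: "ys ! m = ys ! 0"
    using cl m hd_conv_nth[of ys] last_conv_nth[of ys] by simp
  define F where "F \<tau> = ys ! nat (\<tau> mod int m)" for \<tau>
  have in_ys: "F \<tau> \<in> set ys" for \<tau>
  proof -
    have "nat (\<tau> mod int m) < m" using m by (simp add: nat_less_iff)
    then show ?thesis unfolding F_def using m by (intro nth_mem) simp
  qed
  have suc: "F (\<tau> + 1) = ys ! Suc (nat (\<tau> mod int m))" for \<tau>
  proof (cases "\<tau> mod int m = int m - 1")
    case True
    then have "(\<tau> + 1) mod int m = 0" by (metis add.commute diff_add_cancel mod_add_left_eq mod_self)
    moreover have "Suc (nat (\<tau> mod int m)) = m" using True m by simp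
    ultimately show ?thesis using wrap unfolding F_def by simp
  next
    case False
    have b: "0 \<le> \<tau> mod int m" "\<tau> mod int m < int m" using m by simp_all
    have "(\<tau> + 1) mod int m = (\<tau> mod int m + 1) mod int m" by (simp add: mod_add_left_eq)
    also have "\<dots> = \<tau> mod int m + 1" using b False by (intro mod_pos_pos_trivial) auto
    finally show ?thesis using b unfolding F_def by (simp add: nat_add_distrib)
  qed
  have pair: "F (\<tau> - 1) = ys ! nat ((\<tau> - 1) mod int m) \<and> F \<tau> = ys ! Suc (nat ((\<tau> - 1) mod int m))" for \<tau>
    using suc[of "\<tau> - 1"] by (simp add: F_def)
  have lt: "nat (\<tau> mod int m) < m" for \<tau> using m by (simp add: nat_less_iff)
  have "cyclic_flags n (int m) (int k + 1) F"
  proof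
    show "0 < n" "0 < int m" using n m by auto
    show "is_flag n (F \<tau>)" for \<tau> using fl in_ys by blast
    show "F (\<tau> + int m) = F \<tau>" for \<tau> unfolding F_def by simp
    show "\<exists>i<n. \<forall>j\<le>n. j \<noteq> i \<longrightarrow> F (\<tau> + 1) j = F \<tau> j" for \<tau>
      using successively_nth[OF st, of "nat (\<tau> mod int m)"] lt[of \<tau>] m unfolding suc by (simp add: F_def)
    show "\<exists>\<tau>. F (\<tau> - 1) (stars w) \<noteq> w \<and> F \<tau> (stars w) = w" if "length w = n" "stars w < n" for w
    proof -
      have "card {t. Suc t < length ys \<and> (ys ! t) (stars w) \<noteq> w \<and> (ys ! Suc t) (stars w) = w} = 1"
        using en[OF that] by (simp add: entries_eq_card)
      then obtain t where t: "Suc t < length ys" "(ys ! t) (stars w) \<noteq> w" "(ys ! Suc t) (stars w) = w"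
        by (auto simp: card_1_singleton_iff)
      have "nat (int t mod int m) = t" using t m by simp
      then have "F (int t + 1 - 1) (stars w) \<noteq> w \<and> F (int t + 1) (stars w) = w"
        using t pair[of "int t + 1"] by simp
      then show ?thesis by blast
    qed
    show "int m dvd \<tau> - \<sigma>" if r: "r < n" and d: "F (\<tau> - 1) r \<noteq> F \<tau> r" "F (\<sigma> - 1) r \<noteq> F \<sigma> r" and e: "F \<tau> r = F \<sigma> r" for r \<tau> \<sigma>
    proof -
      define w where "w = F \<tau> r"
      have w: "length w = n" "stars w = r" using fl[OF in_ys, of \<tau>] r unfolding w_def is_flag_def by auto
      let ?A = "{t. Suc t < length ys \<and> (ys ! t) r \<noteq> w \<and> (ys ! Suc t) r = w}"
      have "card ?A = 1"
        using en[of w] w r by (simp add: entries_eq_card)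
      then obtain t0 where "?A = {t0}" by (rule card_1_singletonE)
      moreover have "nat ((\<tau> - 1) mod int m) \<in> {t. Suc t < length ys \<and> (ys ! t) r \<noteq> w \<and> (ys ! Suc t) r = w}"
        "nat ((\<sigma> - 1) mod int m) \<in> {t. Suc t < length ys \<and> (ys ! t) r \<noteq> w \<and> (ys ! Suc t) r = w}"
        using d e pair[of \<tau>] pair[of \<sigma>] lt m unfolding w_def by auto
      ultimately have "nat ((\<tau> - 1) mod int m) = nat ((\<sigma> - 1) mod int m)"
        by (simp only: singleton_iff)
      then have "(\<tau> - 1) mod int m = (\<sigma> - 1) mod int m" using m by (simp add: eq_nat_nat_iff)
      then have "int m dvd (\<tau> - 1) - (\<sigma> - 1)" by (simp only: mod_eq_dvd_iff)
      then show ?thesis by simp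
    qed
    have "(- 1) mod int m = int m - 1" using m by (simp add: zmod_minus1)
    moreover have "nat (int m - 1) = m - 1" by linarith
    ultimately have "F (- 1) = ys ! (m - 1)" unfolding F_def by (simp only:)
    moreover have "F 0 = last ys" unfolding F_def using m wrap last_conv_nth[of ys] by simp
    ultimately show "F (- 1) 0 \<noteq> F 0 0" using b m by (simp add: numeral_2_eq_2)
    have "nat (int k mod int m) = k" using k m by simp
    then show "F (int k + 1 - 1) (n - 1) \<noteq> F (int k + 1) (n - 1)" using t pair[of "int k + 1"] by simp
  qed
  then show ?thesis by blast
qed

section \<open>Entry times\<close>

context cyclic_flags
begin

text \<open>Level \<open>i\<close> holds the face of dimension \<open>i - 1\<close>. The empty face
  and the whole cube never change, so they are declared to be re-entered once per period, at the
  marked flips.\<close>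

definition entry_times :: "nat \<Rightarrow> int set" where
  "entry_times i = (if i = 0 then {\<tau>. M dvd \<tau>} else if i \<le> n then {\<tau>. F (\<tau> - 1) (i - 1) \<noteq> F \<tau> (i - 1)}
    else {\<tau>. M dvd \<tau> - K})"

lemma F_shift: "F (\<tau> + k * M) = F \<tau>"
proof (induction k rule: int_induct[of _ 0])
  case (step1 k) then show ?case using periodic[of "\<tau> + k * M"] by (simp add: algebra_simps)
next
  case (step2 k) then show ?case using periodic[of "\<tau> + (k - 1) * M"] by (simp add: algebra_simps)
qed simp

lemma F_top: "F \<tau> n = replicate n None"
  using flag[of \<tau>] stars_eq_length_iff[of "F \<tau> n"] unfolding is_flag_def by simp

lemma F_word: "r \<le> n \<Longrightarrow> length (F \<tau> r) = n \<and> stars (F \<tau> r) = r"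
  using flag[of \<tau>] unfolding is_flag_def by simp

lemma entry_times_shift: "\<tau> + k * M \<in> entry_times i \<longleftrightarrow> \<tau> \<in> entry_times i"
proof -
  have "F (\<tau> + k * M - 1) = F (\<tau> - 1)" using F_shift[of "\<tau> - 1" k] by (simp add: algebra_simps)
  moreover have "M dvd \<tau> + k * M - K \<longleftrightarrow> M dvd \<tau> - K"
    using dvd_add_left_iff[of M "k * M" "\<tau> - K"] by (simp add: algebra_simps)
  ultimately show ?thesis unfolding entry_times_def by (auto simp: F_shift dvd_add_left_iff)
qed

lemma zero_in_entry_times: "0 \<in> entry_times 0" "0 \<in> entry_times 1" and K_in_entry_times: "K \<in> entry_times n" "K \<in> entry_times (Suc n)"
  using n bot top unfolding entry_times_def by auto

lemma entry_times_ne: "\<exists>\<tau>. \<tau> \<in> entry_times i"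
proof (cases "i = 0 \<or> n < i")
  case True
  then show ?thesis unfolding entry_times_def by (auto intro: exI[of _ 0] exI[of _ K])
next
  case False
  then obtain w where "length w = n" "stars w = i - 1"
    using F_word[of "i - 1" 0] by (metis diff_le_self leI order_trans)
  moreover have "i - 1 < n" using False by linarith
  ultimately obtain \<tau> where "F (\<tau> - 1) (i - 1) \<noteq> w" "F \<tau> (i - 1) = w" using enter_ex[of w] by auto
  then show ?thesis using False unfolding entry_times_def by (auto intro: exI[of _ \<tau>])
qed

lemma ex_entry_time_window: "\<exists>\<sigma>\<in>entry_times i. \<tau> - M < \<sigma> \<and> \<sigma> \<le> \<tau>"
proof -
  obtain \<rho> where r: "\<rho> \<in> entry_times i" using entry_times_ne by blast
  let ?s = "\<tau> - (\<tau> - \<rho>) mod M"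
  have "?s = \<rho> + ((\<tau> - \<rho>) div M) * M"
    using div_mult_mod_eq[of "\<tau> - \<rho>" M] by linarith
  then have "?s \<in> entry_times i" using entry_times_shift r by metis
  moreover have "0 \<le> (\<tau> - \<rho>) mod M" "(\<tau> - \<rho>) mod M < M" using M by auto
  ultimately show ?thesis by (intro bexI[of _ ?s]) auto
qed

text \<open>Restricting to a window of one period makes the set finite, and
  \<open>ex_entry_time_window\<close> keeps it nonempty, so that \<open>Max\<close> is
  meaningful.\<close>

definition last_entry :: "nat \<Rightarrow> int \<Rightarrow> int" where
  "last_entry i \<tau> = Max {\<sigma> \<in> entry_times i. \<tau> - M < \<sigma> \<and> \<sigma> \<le> \<tau>}"

lemma last_entry_in: "last_entry i \<tau> \<in> entry_times i" and last_entry_le: "last_entry i \<tau> \<le> \<tau>"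
  and last_entry_max: "\<sigma> \<in> entry_times i \<Longrightarrow> \<sigma> \<le> \<tau> \<Longrightarrow> \<sigma> \<le> last_entry i \<tau>"
proof -
  let ?A = "{\<sigma> \<in> entry_times i. \<tau> - M < \<sigma> \<and> \<sigma> \<le> \<tau>}"
  have fin: "finite ?A" by (rule finite_subset[of _ "{\<tau> - M..\<tau>}"]) auto
  have "?A \<noteq> {}" using ex_entry_time_window[of i \<tau>] by blast
  then have "last_entry i \<tau> \<in> ?A" unfolding last_entry_def using fin Max_in by blast
  then have *: "last_entry i \<tau> \<in> entry_times i" "last_entry i \<tau> \<le> \<tau>" "\<tau> - M < last_entry i \<tau>" by auto
  then show "last_entry i \<tau> \<in> entry_times i" "last_entry i \<tau> \<le> \<tau>" by simp_all
  show "\<sigma> \<le> last_entry i \<tau>" if s: "\<sigma> \<in> entry_times i" "\<sigma> \<le> \<tau>"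
  proof (cases "\<tau> - M < \<sigma>")
    case True
    then show ?thesis unfolding last_entry_def using fin s by (intro Max_ge) auto
  next
    case False
    then show ?thesis using * by linarith
  qed
qed

lemma last_entry_eqI: "\<sigma> \<in> entry_times i \<Longrightarrow> \<sigma> \<le> \<tau> \<Longrightarrow> (\<And>\<rho>. \<rho> \<in> entry_times i \<Longrightarrow> \<rho> \<le> \<tau> \<Longrightarrow> \<rho> \<le> \<sigma>) \<Longrightarrow> last_entry i \<tau> = \<sigma>"
  by (meson last_entry_in last_entry_le last_entry_max order_antisym)

lemma last_entry_mono: "\<tau> \<le> \<sigma> \<Longrightarrow> last_entry i \<tau> \<le> last_entry i \<sigma>"
  by (meson last_entry_in last_entry_le last_entry_max order_trans)

lemma last_entry_shift: "last_entry i (\<tau> + k * M) = last_entry i \<tau> + k * M"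
proof (rule last_entry_eqI)
  show "last_entry i \<tau> + k * M \<in> entry_times i" using last_entry_in entry_times_shift by blast
  show "last_entry i \<tau> + k * M \<le> \<tau> + k * M" using last_entry_le by simp
  fix \<rho> assume "\<rho> \<in> entry_times i" "\<rho> \<le> \<tau> + k * M"
  then have "\<rho> + (- k) * M \<in> entry_times i" "\<rho> + (- k) * M \<le> \<tau>" using entry_times_shift[of \<rho> "- k"] by auto
  then have "\<rho> + (- k) * M \<le> last_entry i \<tau>" by (rule last_entry_max)
  then show "\<rho> \<le> last_entry i \<tau> + k * M" by simp
qed

lemma last_entry_step: "last_entry i (\<tau> + 1) = (if \<tau> + 1 \<in> entry_times i then \<tau> + 1 else last_entry i \<tau>)"
proof (cases "\<tau> + 1 \<in> entry_times i")
  case True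
  then show ?thesis by (simp add: last_entry_eqI)
next
  case False
  have "last_entry i (\<tau> + 1) = last_entry i \<tau>"
  proof (rule last_entry_eqI)
    fix \<rho> assume r: "\<rho> \<in> entry_times i" "\<rho> \<le> \<tau> + 1"
    then have "\<rho> \<noteq> \<tau> + 1" using False by auto
    then show "\<rho> \<le> last_entry i \<tau>" using r by (intro last_entry_max) auto
  qed (use last_entry_in last_entry_le[of i \<tau>] in auto)
  then show ?thesis using False by simp
qed

lemma F_const:
  assumes "r < n" "\<sigma> \<le> \<tau>" "last_entry (Suc r) \<tau> \<le> \<sigma>"
  shows "F \<tau> r = F \<sigma> r"
  using assms(2,3)
proof (induction \<tau> rule: int_ge_induct)
  case (step \<tau>)
  have no: "\<tau> + 1 \<notin> entry_times (Suc r)"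
  proof
    assume "\<tau> + 1 \<in> entry_times (Suc r)"
    then have "\<tau> + 1 \<le> last_entry (Suc r) (\<tau> + 1)" by (rule last_entry_max) simp
    then show False using step by linarith
  qed
  then have "F (\<tau> + 1) r = F \<tau> r" using assms(1) unfolding entry_times_def by auto
  then show ?case using step no by (simp add: last_entry_step)
qed simp

lemma F_last_entry: "r < n \<Longrightarrow> F \<tau> r = F (last_entry (Suc r) \<tau>) r"
  by (rule F_const) (auto simp: last_entry_le)

text \<open>A proper face is entered once per period, so it is determined by the time of its last
  entry modulo \<open>M\<close>, and conversely.\<close>

lemma same_iff: "r < n \<Longrightarrow> F \<tau> r = F \<sigma> r \<longleftrightarrow> M dvd last_entry (Suc r) \<tau> - last_entry (Suc r) \<sigma>"
proof
  assume r: "r < n" and e: "F \<tau> r = F \<sigma> r"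
  have "F (last_entry (Suc r) \<tau> - 1) r \<noteq> F (last_entry (Suc r) \<tau>) r" "F (last_entry (Suc r) \<sigma> - 1) r \<noteq> F (last_entry (Suc r) \<sigma>) r"
    using last_entry_in[of "Suc r" \<tau>] last_entry_in[of "Suc r" \<sigma>] r unfolding entry_times_def by auto
  then show "M dvd last_entry (Suc r) \<tau> - last_entry (Suc r) \<sigma>"
    using enter_unique[OF r] e F_last_entry[OF r] by metis
next
  assume r: "r < n" and "M dvd last_entry (Suc r) \<tau> - last_entry (Suc r) \<sigma>"
  then obtain k where "last_entry (Suc r) \<tau> = last_entry (Suc r) \<sigma> + k * M" by (auto simp: dvd_def algebra_simps)
  then have "F (last_entry (Suc r) \<tau>) r = F (last_entry (Suc r) \<sigma>) r" by (simp add: F_shift)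
  then show "F \<tau> r = F \<sigma> r" using F_last_entry[OF r, of \<tau>] F_last_entry[OF r, of \<sigma>] by simp
qed

lemma last_entry_bot: "M dvd last_entry 0 \<tau>" and last_entry_top: "M dvd last_entry (Suc n) \<tau> - K"
  using last_entry_in[of 0 \<tau>] last_entry_in[of "Suc n" \<tau>] unfolding entry_times_def by auto

text \<open>The marked times are themselves flips of the neighbouring level: re-entering an extreme
  element therefore never needs a step of its own.\<close>

lemma entry_times_bot_subset: "entry_times 0 \<subseteq> entry_times 1" and entry_times_top_subset: "entry_times (Suc n) \<subseteq> entry_times n"
proof
  fix \<tau> assume "\<tau> \<in> entry_times 0"
  then obtain k where "\<tau> = 0 + k * M" unfolding entry_times_def by (auto simp: dvd_def mult.commute)
  then show "\<tau> \<in> entry_times 1" using entry_times_shift[of 0 k 1] zero_in_entry_times by simp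
next
  show "entry_times (Suc n) \<subseteq> entry_times n"
  proof
    fix \<tau> assume "\<tau> \<in> entry_times (Suc n)"
    then obtain k where "\<tau> = K + k * M" unfolding entry_times_def by (auto simp: dvd_def algebra_simps)
    then show "\<tau> \<in> entry_times n" using entry_times_shift[of K k n] K_in_entry_times by simp
  qed
qed

text \<open>Entries at level \<open>i\<close> coincide with entries at level \<open>j\<close>, so
  none can follow the last entry at level \<open>j\<close>.\<close>

lemma last_entry_last_entry: "entry_times i \<subseteq> entry_times j \<Longrightarrow> last_entry i \<tau> = last_entry i (last_entry j \<tau>)"
  by (meson last_entry_eqI last_entry_in last_entry_le last_entry_max order_trans subsetD)

text \<open>
  Were an edge \<open>u < v\<close> drawn twice with different winding, a whole turn of the upper level would
  take place while \<open>u\<close> stays, so that \<open>u\<close> would lie below every element of that level.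
\<close>

lemma all_between:
  assumes r: "Suc r < n" and w: "length w = n" "stars w = Suc r"
    and lo: "last_entry (Suc r) \<tau> = last_entry (Suc r) \<sigma>" and hi: "last_entry (Suc (Suc r)) \<sigma> + M \<le> last_entry (Suc (Suc r)) \<tau>"
  shows "word_le (F \<sigma> r) w"
proof -
  obtain \<rho>0 where r0: "F (\<rho>0 - 1) (Suc r) \<noteq> w" "F \<rho>0 (Suc r) = w" using enter_ex[of w] w r by auto
  have "\<rho>0 \<in> entry_times (Suc (Suc r))" using r0 r unfolding entry_times_def by auto
  let ?e = "last_entry (Suc (Suc r)) \<tau>"
  \<comment> \<open>The entry time of \<open>w\<close> in the period that ends with
    \<open>?e\<close>.\<close>
  define \<rho> where "\<rho> = ?e - (?e - \<rho>0) mod M"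
  have re: "\<rho> = \<rho>0 + ((?e - \<rho>0) div M) * M"
    using div_mult_mod_eq[of "?e - \<rho>0" M] unfolding \<rho>_def by linarith
  have rho: "\<rho> \<in> entry_times (Suc (Suc r))" using entry_times_shift \<open>\<rho>0 \<in> _\<close> re by metis
  have b: "0 \<le> (?e - \<rho>0) mod M" "(?e - \<rho>0) mod M < M" using M by auto
  have 1: "\<rho> \<le> \<tau>" using b last_entry_le[of "Suc (Suc r)" \<tau>] unfolding \<rho>_def by linarith
  have "last_entry (Suc (Suc r)) \<sigma> < \<rho>" using b hi unfolding \<rho>_def by linarith
  then have 2: "\<sigma> < \<rho>" using last_entry_max[OF rho, of \<sigma>] by linarith
  have rn: "r < n" using r by simp
  have "last_entry (Suc r) \<rho> = last_entry (Suc r) \<sigma>"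
    using last_entry_mono[of \<sigma> \<rho> "Suc r"] last_entry_mono[of \<rho> \<tau> "Suc r"] 1 2 lo by simp
  then have "F \<rho> r = F \<sigma> r" using same_iff[OF rn] by simp
  moreover have "F \<rho> (Suc r) = w" using F_shift[of \<rho>0] r0 re by simp
  ultimately show ?thesis using flag[of \<rho>] rn unfolding is_flag_def by metis
qed

end

text \<open>A proper face fixes some coordinate; fix it to the opposite value. Because
  \<open>k < n\<close>, the other coordinates suffice for \<open>k\<close> free ones.\<close>

lemma ex_not_above:
  assumes "length u = n" "stars u < n" "k < n"
  shows "\<exists>w. length w = n \<and> stars w = k \<and> \<not> word_le u w"
proof -
  have "u \<noteq> replicate n None" using assms stars_eq_length_iff[of u] by auto
  then obtain j where j: "j < n" "u ! j \<noteq> None" using assms(1) by (metis nth_equalityI length_replicate nth_replicate)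
  then obtain b where b: "u ! j = Some b" by auto
  have st: "stars (replicate a None @ replicate c (Some d)) = a" for a c d
    by (induction a) (simp_all, induction c, simp_all)
  have ex: "\<exists>v. length v = n - 1 \<and> stars v = k"
    using assms(3) st[of k "n - 1 - k" True] by (intro exI[of _ "replicate k None @ replicate (n - 1 - k) (Some True)"]) auto
  then obtain v where v: "length v = n - 1" "stars v = k" by blast
  define w where "w = take j v @ Some (\<not> b) # drop j v"
  have len: "length w = n" using j v unfolding w_def by simp
  have "stars w = stars (take j v @ drop j v)" unfolding w_def stars_def by (simp only: count_list_append) simp
  then have "stars w = k" using v by simp
  moreover have "w ! j = Some (\<not> b)" using j v unfolding w_def by (simp add: nth_append)
  then have "\<not> word_le u w" using b j assms(1) unfolding word_le_def by (auto dest: list_all2_nthD)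
  ultimately show ?thesis using len by blast
qed

text \<open>Keeps the geometry of faces out of the combinatorics: \<open>g\<close> realises the
  words and \<open>z\<close> stands for the empty face.\<close>

theorem has_rhombic_strip_words:
  fixes g :: "word \<Rightarrow> 'v::order" and z :: 'v and \<rho> :: "'v \<Rightarrow> int"
  assumes n: "0 < n" and V: "V = insert z (g ` {w. length w = n})"
    and inj: "inj_on g {w. length w = n}"
    and less: "\<And>u w. length u = n \<Longrightarrow> length w = n \<Longrightarrow> word_le u w \<Longrightarrow> stars u < stars w \<Longrightarrow> g u < g w"
    and z_less: "\<And>w. length w = n \<Longrightarrow> z < g w"
    and rank: "\<And>w. length w = n \<Longrightarrow> \<rho> (g w) = int (stars w)" "\<rho> z = -1"
  shows "has_rhombic_strip V \<rho>"
proof -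
  obtain M K F where "cyclic_flags n M K F" using ex_cyclic_flags[OF n] by blast
  then interpret cyclic_flags n M K F .
  define lab where "lab i \<tau> = (case i of 0 \<Rightarrow> z | Suc r \<Rightarrow> g (F \<tau> r))" for i \<tau>
  \<comment> \<open>Dividing by \<open>M\<close> turns one period into one turn of the
    cylinder.\<close>
  define X where "X i \<tau> = real_of_int (last_entry i \<tau>) / real_of_int M" for i \<tau>
  have X_eq: "X i \<tau> = X j \<sigma> \<longleftrightarrow> last_entry i \<tau> = last_entry j \<sigma>" for i j \<tau> \<sigma> unfolding X_def using M by simp
  have X_Ints: "X i \<tau> - X i \<sigma> \<in> \<int> \<longleftrightarrow> M dvd last_entry i \<tau> - last_entry i \<sigma>" for i \<tau> \<sigma>
  proof -
    have "X i \<tau> - X i \<sigma> = of_int (last_entry i \<tau> - last_entry i \<sigma>) / of_int M" unfolding X_def by (simp add: diff_divide_distrib)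
    then show ?thesis using M by (simp only: of_int_div_of_int_in_Ints_iff) auto
  qed
  have g_eq: "g (F \<tau> r) = g (F \<sigma> r) \<longleftrightarrow> F \<tau> r = F \<sigma> r" if "r \<le> n" for r \<tau> \<sigma>
    using inj F_word[OF that] by (auto simp: inj_on_eq_iff)
  have lab_iff: "lab i \<tau> = lab i \<sigma> \<longleftrightarrow> M dvd last_entry i \<tau> - last_entry i \<sigma>" if "i \<le> Suc n" for i \<tau> \<sigma>
  proof (cases i)
    case 0
    then show ?thesis using last_entry_bot by (simp add: lab_def dvd_diff)
  next
    case (Suc r)
    show ?thesis
    proof (cases "r = n")
      case True
      have "M dvd (last_entry (Suc n) \<tau> - K) - (last_entry (Suc n) \<sigma> - K)" using dvd_diff[OF last_entry_top last_entry_top] .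
      then show ?thesis using Suc True F_top by (simp add: lab_def)
    next
      case False
      then show ?thesis using Suc that g_eq same_iff by (simp add: lab_def)
    qed
  qed
  have "strip (Suc n) M V \<rho> lab X"
  proof
    show "2 \<le> Suc n" "0 < M" using n M by auto
    show "X i (\<tau> + M) = X i \<tau> + 1" for i \<tau>
      using last_entry_shift[of i \<tau> 1] M unfolding X_def by (simp add: add_divide_distrib)
    show "X i \<tau> \<le> X i (\<tau> + 1)" for i \<tau>
      using last_entry_mono[of \<tau> "\<tau> + 1" i] M unfolding X_def by (simp add: divide_right_mono)
    show "lab i \<tau> = lab i \<sigma> \<longleftrightarrow> X i \<tau> - X i \<sigma> \<in> \<int>" if "i \<le> Suc n" for i \<tau> \<sigma>
      using lab_iff[OF that] X_Ints by simp
    show "V = {lab i \<tau> | i \<tau>. i \<le> Suc n}"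
    proof (intro set_eqI iffI)
      fix v assume "v \<in> V"
      then consider "v = z" | w where "length w = n" "v = g w" unfolding V by auto
      then show "v \<in> {lab i \<tau> | i \<tau>. i \<le> Suc n}"
      proof cases
        case 1
        then have "v = lab 0 0" by (simp add: lab_def)
        then show ?thesis by blast
      next
        case (2 w)
        have "\<exists>\<tau>. F \<tau> (stars w) = w"
        proof (cases "stars w < n")
          case True
          then show ?thesis using enter_ex[OF 2(1)] by blast
        next
          case False
          then have "stars w = n" using stars_le_length[of w] 2 by simp
          then show ?thesis using stars_eq_length_iff[of w] 2 F_top by auto
        qed
        then obtain \<tau> where "F \<tau> (stars w) = w" by blast
        then have "v = lab (Suc (stars w)) \<tau>" using 2 by (simp add: lab_def)
        moreover have "Suc (stars w) \<le> Suc n" using stars_le_length[of w] 2 by simp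
        ultimately show ?thesis by blast
      qed
    next
      fix v assume "v \<in> {lab i \<tau> | i \<tau>. i \<le> Suc n}"
      then show "v \<in> V" using F_word unfolding V lab_def by (auto split: nat.split)
    qed
    show "\<rho> (lab i \<tau>) = int i - 1" if "i \<le> Suc n" for i \<tau>
      using that F_word rank by (cases i) (auto simp: lab_def)
    show "lab i \<tau> < lab (Suc i) \<tau>" if "i < Suc n" for i \<tau>
    proof (cases i)
      case 0
      then show ?thesis using z_less F_word[of 0 \<tau>] by (simp add: lab_def)
    next
      case (Suc r)
      then have "word_le (F \<tau> r) (F \<tau> (Suc r))" using flag[of \<tau>] that unfolding is_flag_def by simp
      then show ?thesis using Suc that F_word[of r \<tau>] F_word[of "Suc r" \<tau>] less by (simp add: lab_def)
    qed
    show "lab 0 \<tau> = lab 0 \<sigma>" for \<tau> \<sigma> by (simp add: lab_def)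
    show "lab (Suc n) \<tau> = lab (Suc n) \<sigma>" for \<tau> \<sigma> by (simp add: lab_def F_top)
    show "X i \<tau> - X i \<sigma> = X (Suc i) \<tau> - X (Suc i) \<sigma>"
      if i: "i < Suc n" and l: "lab i \<tau> = lab i \<sigma>" "lab (Suc i) \<tau> = lab (Suc i) \<sigma>" for i \<tau> \<sigma>
    proof -
      have "last_entry i \<tau> - last_entry i \<sigma> = last_entry (Suc i) \<tau> - last_entry (Suc i) \<sigma>"
      proof -
        obtain k where k: "last_entry i \<tau> = last_entry i \<sigma> + k * M"
          using l(1) lab_iff[of i \<tau> \<sigma>] i by (auto simp: dvd_def algebra_simps)
        obtain k' where k': "last_entry (Suc i) \<tau> = last_entry (Suc i) \<sigma> + k' * M"
          using l(2) lab_iff[of "Suc i" \<tau> \<sigma>] i by (auto simp: dvd_def algebra_simps)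
        have "k = k'"
        proof -
          \<comment> \<open>At both ends the single element is re-entered only together with its
            neighbour, so the two make the same number of turns. Elsewhere
            \<open>all_between\<close> and \<open>ex_not_above\<close> exclude different
            numbers.\<close>
          consider "i = 0" | "i = n" "i \<noteq> 0" | r where "i = Suc r" "Suc r < n" using i by (cases i) force+
          then show ?thesis
          proof cases
            case 1
            have "last_entry 0 \<tau> = last_entry 0 (last_entry 1 \<sigma> + k' * M)" using last_entry_last_entry[OF entry_times_bot_subset, of \<tau>] k' 1 by simp
            also have "\<dots> = last_entry 0 \<sigma> + k' * M" using last_entry_last_entry[OF entry_times_bot_subset, of \<sigma>] last_entry_shift by simp
            finally show ?thesis using k 1 M by simp
          next
            case 2
            have "last_entry (Suc n) \<tau> = last_entry (Suc n) (last_entry n \<sigma> + k * M)" using last_entry_last_entry[OF entry_times_top_subset, of \<tau>] k 2 by simp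
            also have "\<dots> = last_entry (Suc n) \<sigma> + k * M" using last_entry_last_entry[OF entry_times_top_subset, of \<sigma>] last_entry_shift by simp
            finally show ?thesis using k' 2 M by simp
          next
            case (3 r)
            have neq: False if lo: "last_entry (Suc r) \<alpha> = last_entry (Suc r) \<beta>"
              and hi: "last_entry (Suc (Suc r)) \<beta> + M \<le> last_entry (Suc (Suc r)) \<alpha>" for \<alpha> \<beta>
            proof -
              obtain w where "length w = n" "stars w = Suc r" "\<not> word_le (F \<beta> r) w"
                using ex_not_above[of "F \<beta> r" n "Suc r"] F_word[of r \<beta>] 3 by auto
              then show False using all_between[OF 3(2) _ _ lo hi] by blast
            qed
            show ?thesis
            proof (rule ccontr)
              assume "k \<noteq> k'"
              then consider "k + 1 \<le> k'" | "k' + 1 \<le> k" by linarith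
              then show False
              proof cases
                case 1
                then have "(k + 1) * M \<le> k' * M" using M by (intro mult_right_mono) auto
                then show False using neq[of \<tau> "\<sigma> + k * M", unfolded last_entry_shift] k k' 3 by (simp add: algebra_simps)
              next
                case 2
                then have "(k' + 1) * M \<le> k * M" using M by (intro mult_right_mono) auto
                then show False using neq[of "\<sigma> + k * M" \<tau>, unfolded last_entry_shift] k k' 3 by (simp add: algebra_simps)
              qed
            qed
          qed
        qed
        then show ?thesis using k k' by simp
      qed
      then show ?thesis unfolding X_def by (metis diff_divide_distrib of_int_diff)
    qed
    show "\<exists>l. 0 < l \<and> l < Suc n \<and> X l \<tau> \<noteq> X l (\<tau> + 1) \<and> lab l \<tau> \<noteq> lab l (\<tau> + 1) \<and>
        (\<forall>i. 0 < i \<and> i < Suc n \<and> i \<noteq> l \<longrightarrow> X i (\<tau> + 1) = X i \<tau>) \<and>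
        (X 0 \<tau> \<noteq> X 0 (\<tau> + 1) \<longrightarrow> l = 1) \<and> (X (Suc n) \<tau> \<noteq> X (Suc n) (\<tau> + 1) \<longrightarrow> Suc l = Suc n)"
      if i: "i \<le> Suc n" and d: "X i \<tau> \<noteq> X i (\<tau> + 1)" for i \<tau>
    proof -
      have move: "X j (\<tau> + 1) \<noteq> X j \<tau> \<longleftrightarrow> \<tau> + 1 \<in> entry_times j" for j
        using last_entry_le[of j \<tau>] by (auto simp: X_eq last_entry_step)
      have inner: "\<tau> + 1 \<in> entry_times (Suc r) \<longleftrightarrow> F (\<tau> + 1) r \<noteq> F \<tau> r" if "r < n" for r
        using that unfolding entry_times_def by auto
      have bot1: "\<tau> + 1 \<in> entry_times 0 \<Longrightarrow> \<tau> + 1 \<in> entry_times (Suc 0)" using entry_times_bot_subset by auto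
      have top1: "\<tau> + 1 \<in> entry_times (Suc n) \<Longrightarrow> \<tau> + 1 \<in> entry_times n" using entry_times_top_subset by auto
      \<comment> \<open>Level \<open>l0\<close> of the flag is level \<open>Suc l0\<close> of the
        strip.\<close>
      obtain l0 where l0: "l0 < n" "\<And>j. j \<le> n \<Longrightarrow> j \<noteq> l0 \<Longrightarrow> F (\<tau> + 1) j = F \<tau> j"
        using flip1 by blast
      have only: "j = Suc l0" if "0 < j" "j \<le> n" "\<tau> + 1 \<in> entry_times j" for j
      proof -
        have "F (\<tau> + 1) (j - 1) \<noteq> F \<tau> (j - 1)" using inner[of "j - 1"] that by simp
        then show ?thesis using l0(2)[of "j - 1"] that by fastforce
      qed
      have "\<tau> + 1 \<in> entry_times i" using d move by metis
      then have "\<exists>j. 0 < j \<and> j \<le> n \<and> \<tau> + 1 \<in> entry_times j"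
        using i bot1 top1 n by (cases "i = 0"; cases "i = Suc n") (auto simp: le_Suc_eq Suc_le_eq)
      then have E: "\<tau> + 1 \<in> entry_times (Suc l0)" using only by blast
      have "X (Suc l0) \<tau> \<noteq> X (Suc l0) (\<tau> + 1)" using E move by metis
      moreover have "lab (Suc l0) \<tau> \<noteq> lab (Suc l0) (\<tau> + 1)"
        using E inner[OF l0(1)] g_eq[of l0 \<tau> "\<tau> + 1"] l0(1) by (auto simp: lab_def)
      moreover have "X j (\<tau> + 1) = X j \<tau>" if "0 < j" "j < Suc n" "j \<noteq> Suc l0" for j
        using only[of j] move[of j] that by auto
      moreover have "Suc l0 = 1" if "X 0 \<tau> \<noteq> X 0 (\<tau> + 1)"
        using only[of "Suc 0"] bot1 move[of 0] that n by fastforce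
      moreover have "Suc (Suc l0) = Suc n" if "X (Suc n) \<tau> \<noteq> X (Suc n) (\<tau> + 1)"
        using only[of n] top1 move[of "Suc n"] that n by fastforce
      ultimately show ?thesis using l0(1) by (intro exI[of _ "Suc l0"]) simp
    qed
  qed
  then show ?thesis by (rule strip.has_rhombic_strip)
qed

section \<open>Faces of the cube\<close>

text \<open>\<open>h\<close> gives the place of each coordinate in the word. As a nonempty box, a
  face is determined by its two corners, whence injectivity.\<close>

definition cube_face :: "('n \<Rightarrow> nat) \<Rightarrow> word \<Rightarrow> (real ^ 'n) set" where
  "cube_face h w = cbox (\<chi> i. if w ! h i = Some True then 1 else 0) (\<chi> i. if w ! h i = Some False then 0 else 1)"

lemma mem_cube_face: "x \<in> cube_face h w \<longleftrightarrow>
    (\<forall>i. 0 \<le> x $ i \<and> x $ i \<le> 1 \<and> (\<forall>b. w ! h i = Some b \<longrightarrow> x $ i = of_bool b))"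
  unfolding cube_face_def mem_box_cart
proof (intro iff_allI)
  fix i
  show "((\<chi> i. if w ! h i = Some True then 1 else 0) $ i \<le> x $ i \<and>
      x $ i \<le> (\<chi> i. if w ! h i = Some False then 0 else 1) $ i) =
    (0 \<le> x $ i \<and> x $ i \<le> 1 \<and> (\<forall>b. w ! h i = Some b \<longrightarrow> x $ i = of_bool b))"
    by (cases "w ! h i") (auto split: if_splits)
qed

lemma hypercube_eq: "(hypercube :: (real ^ 'n) set) = {x. \<forall>i. 0 \<le> x $ i \<and> x $ i \<le> 1}"
proof -
  have "(hypercube :: (real ^ 'n) set) = cbox 0 1"
    unfolding hypercube_def Cart_1 unit_interval_convex_hull
    by (rule arg_cong[where f = "(hull) convex"]) (simp add: Basis_vec_def inner_axis)
  then show ?thesis by (simp add: set_eq_iff mem_box_cart)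
qed

lemma segment_at_end:
  fixes a b u c :: real
  assumes "0 < u" "u < 1" "0 \<le> a" "a \<le> 1" "0 \<le> b" "b \<le> 1" "(1 - u) * a + u * b = c" "c = 0 \<or> c = 1"
  shows "a = c \<and> b = c"
  using assms(8)
proof
  assume c: "c = 0"
  have "0 \<le> (1 - u) * a" "0 \<le> u * b" using assms by simp_all
  then have "(1 - u) * a = 0" "u * b = 0" using assms(7) c by linarith+
  then show ?thesis using assms c by simp
next
  assume c: "c = 1"
  have "0 \<le> (1 - u) * (1 - a)" "0 \<le> u * (1 - b)" using assms by simp_all
  moreover have "(1 - u) * (1 - a) + u * (1 - b) = 0" using assms(7) c by (simp add: algebra_simps)
  ultimately have "(1 - u) * (1 - a) = 0" "u * (1 - b) = 0" by linarith+
  then show ?thesis using assms c by simp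
qed

text \<open>A coordinate that equals 0 or 1 inside a segment of the cube has that value at both
  ends, because 0 and 1 are extreme in the unit interval.\<close>

lemma cube_face_face_of: "(cube_face h w :: (real ^ 'n) set) face_of hypercube"
  unfolding face_of_def
proof (intro conjI ballI impI)
  show "(cube_face h w :: (real ^ 'n) set) \<subseteq> hypercube" by (auto simp: mem_cube_face hypercube_eq)
  show "convex (cube_face h w :: (real ^ 'n) set)" unfolding cube_face_def by (rule convex_box)
  fix a b x :: "real ^ 'n"
  assume a: "a \<in> hypercube" and b: "b \<in> hypercube" and x: "x \<in> cube_face h w" and s: "x \<in> open_segment a b"
  obtain u where u: "0 < u" "u < 1" "x = (1 - u) *\<^sub>R a + u *\<^sub>R b" using s by (auto simp: in_segment)
  have e: "a $ i = of_bool v \<and> b $ i = of_bool v" if "w ! h i = Some v" for i v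
    using segment_at_end[of u "a $ i" "b $ i" "of_bool v"] u a b x that unfolding hypercube_eq mem_cube_face by auto
  show "a \<in> cube_face h w" "b \<in> cube_face h w"
    using e a b unfolding hypercube_eq mem_cube_face by blast+
qed

section \<open>Dimension of the coded faces, and completeness of the coding\<close>

context
  fixes h :: "'n::finite \<Rightarrow> nat"
  assumes h: "bij_betw h UNIV {0..<CARD('n)}"
begin

lemma h_less: "h i < CARD('n)" and h_surj: "k < CARD('n) \<Longrightarrow> \<exists>i. h i = k" and h_inj: "inj h"
  using h unfolding bij_betw_def by (auto simp: set_eq_iff image_iff) (metis atLeastLessThan_iff le0 rangeI)+

lemma word_eqI: "length u = CARD('n) \<Longrightarrow> length w = CARD('n) \<Longrightarrow> (\<And>i. u ! h i = w ! h i) \<Longrightarrow> u = w"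
  using h_surj by (metis nth_equalityI)

lemma cube_face_ne: "cube_face h w \<noteq> {}"
proof -
  have "(\<chi> i. if w ! h i = Some True then 1 else 0) \<in> cube_face h w"
    by (auto simp: mem_cube_face split: if_splits)
  then show ?thesis by auto
qed

lemma inj_on_cube_face: "inj_on (cube_face h) {w. length w = CARD('n)}"
proof (rule inj_onI)
  fix u w :: word assume uw: "u \<in> {w. length w = CARD('n)}" "w \<in> {w. length w = CARD('n)}" and e: "cube_face h u = cube_face h w"
  have *: "(if u ! h i = Some True then 1 else 0 :: real) = (if w ! h i = Some True then 1 else 0)"
    "(if u ! h i = Some False then 0 else 1 :: real) = (if w ! h i = Some False then 0 else 1)" for i
    using e cube_face_ne[of u] unfolding cube_face_def eq_cbox by (auto simp: vec_eq_iff)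
  have "u ! h i = w ! h i" for i
    using *[of i] by (cases "u ! h i"; cases "w ! h i") (auto split: if_splits)
  then show "u = w" using uw by (intro word_eqI) auto
qed

lemma card_stars:
  assumes "length w = CARD('n)" shows "card {i. w ! h i = None} = stars w"
proof -
  have "stars w = card {k. k < length w \<and> w ! k = None}"
    unfolding stars_def count_list_eq_length_filter length_filter_conv_card by (simp add: eq_commute)
  also have "{k. k < length w \<and> w ! k = None} = h ` {i. w ! h i = None}"
    using assms h_less h_surj by auto
  also have "card \<dots> = card {i. w ! h i = None}" using h_inj by (intro card_image) (auto intro: inj_on_subset)
  finally show ?thesis by simp
qed

text \<open>Translated by its lower corner, the face contains the unit vectors of its free
  directions and lies in their span.\<close>

lemma aff_dim_cube_face:
  assumes "length w = CARD('n)" shows "aff_dim (cube_face h w) = int (stars w)"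
proof -
  let ?d = "{i. w ! h i = None}"
  define a :: "real ^ 'n" where "a = (\<chi> i. if w ! h i = Some True then 1 else 0)"
  let ?T = "(\<lambda>x. x - a) ` cube_face h w"
  let ?B = "(\<lambda>i. axis i 1 :: real ^ 'n) ` ?d"
  have a: "a \<in> cube_face h w" unfolding a_def by (auto simp: mem_cube_face split: if_splits)
  have "dim ?T = card ?B"
  proof (rule dim_unique)
    show "?B \<subseteq> ?T"
    proof
      fix y assume "y \<in> ?B"
      then obtain j where j: "w ! h j = None" "y = axis j 1" by auto
      have "a + y \<in> cube_face h w"
        using j unfolding a_def mem_cube_face by (auto simp: axis_def split: if_splits)
      then show "y \<in> ?T" by (intro image_eqI[of _ _ "a + y"]) auto
    qed
    show "?T \<subseteq> span ?B"
    proof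
      fix y assume "y \<in> ?T"
      then obtain x where x: "x \<in> cube_face h w" "y = x - a" by auto
      have y0: "y $ i = 0" if "w ! h i \<noteq> None" for i
        using x that unfolding mem_cube_face a_def by (cases "w ! h i") (auto split: if_splits)
      have "y = (\<Sum>i\<in>UNIV. y $ i *\<^sub>R axis i 1)"
        using basis_expansion[of y] by (simp add: scalar_mult_eq_scaleR)
      also have "\<dots> = (\<Sum>i\<in>?d. y $ i *\<^sub>R axis i 1)"
        by (rule sum.mono_neutral_right) (auto simp: y0)
      also have "\<dots> \<in> span ?B" by (intro span_sum span_scale span_base) auto
      finally show "y \<in> span ?B" .
    qed
    show "independent ?B"
      by (rule independent_mono[OF independent_Basis]) (auto simp: Basis_vec_def)
  qed simp
  also have "card ?B = stars w"
    using card_stars[OF assms] by (subst card_image) (auto simp: inj_on_def axis_eq_axis)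
  finally show ?thesis using a aff_dim_eq_dim_subtract[of a "cube_face h w"] hull_inc by metis
qed

lemma cube_face_mono:
  assumes "length u = CARD('n)" "word_le u w"
  shows "cube_face h u \<subseteq> cube_face h w"
proof
  fix x assume x: "x \<in> cube_face h u"
  have "u ! h i = w ! h i \<or> w ! h i = None" for i
    using assms h_less[of i] unfolding word_le_def by (auto dest: list_all2_nthD)
  then show "x \<in> cube_face h w" using x unfolding mem_cube_face by (metis option.distinct(1))
qed

text \<open>The word is read off a relative interior point \<open>z\<close>, with a free coordinate
  wherever \<open>z\<close> is neither 0 nor 1. The coded face contains \<open>z\<close>, hence all
  of \<open>F\<close>. Conversely, any segment from a point \<open>y\<close> of the coded face to
  \<open>z\<close> can be prolonged inside the cube, so \<open>F\<close> contains
  \<open>y\<close>.\<close>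

lemma face_of_hypercube_cases:
  assumes F: "F face_of (hypercube :: (real ^ 'n) set)" and ne: "F \<noteq> {}"
  shows "\<exists>w. length w = CARD('n) \<and> F = cube_face h w"
proof -
  have "convex F" using F face_of_imp_convex by blast
  then obtain z where z: "z \<in> rel_interior F" using ne rel_interior_eq_empty by blast
  then have zF: "z \<in> F" using rel_interior_subset by blast
  have Fc: "F \<subseteq> hypercube" using F face_of_imp_subset by blast
  then have zc: "0 \<le> z $ i" "z $ i \<le> 1" for i using zF unfolding hypercube_eq by auto
  define c where "c i = (if z $ i = 0 then Some False else if z $ i = 1 then Some True else None)" for i
  define w where "w = map (\<lambda>k. c (inv h k)) [0..<CARD('n)]"
  have w: "w ! h i = c i" for i using h_less[of i] h_inj unfolding w_def by simp
  have zw: "z \<in> cube_face h w" using zc unfolding mem_cube_face w c_def by auto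
  have "F \<subseteq> cube_face h w"
    using subset_of_face_of[OF cube_face_face_of Fc] z zw by blast
  moreover have "cube_face h w \<subseteq> F"
  proof
    fix y assume y: "y \<in> cube_face h w"
    \<comment> \<open>\<open>Min A\<close> is how far one may go beyond \<open>z\<close> without
      leaving the cube; the element 1 keeps the set nonempty when \<open>z\<close> is a
      vertex.\<close>
    define A where "A = insert 1 ((\<lambda>i. min (z $ i) (1 - z $ i)) ` {i. c i = None})"
    define e where "e = Min A"
    have fin: "finite A" unfolding A_def by simp
    have "0 < x" if "x \<in> A" for x
      using that zc unfolding A_def c_def by (auto split: if_splits simp: less_le)
    then have e0: "0 < e" unfolding e_def using fin by (subst Min_gr_iff) (auto simp: A_def)
    have e1: "e \<le> z $ i" "e \<le> 1 - z $ i" if "c i = None" for i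
    proof -
      have "e \<le> min (z $ i) (1 - z $ i)" unfolding e_def using fin that by (intro Min_le) (auto simp: A_def)
      then show "e \<le> z $ i" "e \<le> 1 - z $ i" by auto
    qed
    define y' where "y' = z + e *\<^sub>R (z - y)"
    have "y' \<in> hypercube"
      unfolding hypercube_eq
    proof (intro CollectI allI)
      fix i
      show "0 \<le> y' $ i \<and> y' $ i \<le> 1"
      proof (cases "c i")
        case None
        have "0 \<le> y $ i" "y $ i \<le> 1" using y unfolding mem_cube_face by auto
        then have "\<bar>z $ i - y $ i\<bar> \<le> 1" using zc[of i] by auto
        then have "\<bar>e * (z $ i - y $ i)\<bar> \<le> e" using e0 by (simp add: abs_mult)
        then show ?thesis using e1[OF None] unfolding y'_def by (simp add: abs_le_iff)
      next
        case (Some b)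
        then have "z $ i = y $ i" using y zw w unfolding mem_cube_face by metis
        then show ?thesis using zc[of i] unfolding y'_def by simp
      qed
    qed
    moreover have "y \<in> hypercube" using y unfolding mem_cube_face hypercube_eq by auto
    moreover have "y \<noteq> y' \<Longrightarrow> z \<in> open_segment y y'"
    proof -
      assume "y \<noteq> y'"
      have "z = (1 - 1 / (1 + e)) *\<^sub>R y + (1 / (1 + e)) *\<^sub>R y'"
      proof -
        have "(1 + e) *\<^sub>R z = e *\<^sub>R y + y'" unfolding y'_def by (simp add: algebra_simps)
        then have "(1 / (1 + e)) *\<^sub>R (1 + e) *\<^sub>R z = (1 / (1 + e)) *\<^sub>R (e *\<^sub>R y + y')" by simp
        then have "z = (1 / (1 + e)) *\<^sub>R (e *\<^sub>R y + y')" using e0 by simp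
        moreover have "1 - 1 / (1 + e) = e / (1 + e)" using e0 by (simp add: field_simps)
        ultimately show ?thesis by (simp add: scaleR_add_right)
      qed
      then show ?thesis using \<open>y \<noteq> y'\<close> e0 unfolding in_segment by (auto intro!: exI[of _ "1 / (1 + e)"])
    qed
    moreover have "y = y' \<Longrightarrow> y = z"
    proof -
      assume "y = y'"
      then have "(1 + e) *\<^sub>R (z - y) = 0" unfolding y'_def by (simp add: algebra_simps)
      then show ?thesis using e0 by simp
    qed
    ultimately show "y \<in> F" using face_ofD[OF F, of z y y'] zF by blast
  qed
  moreover have "length w = CARD('n)" unfolding w_def by simp
  ultimately show ?thesis by blast
qed

lemma face_lattice_hypercube:
  "face_lattice (hypercube :: (real ^ 'n) set) = insert {} (cube_face h ` {w. length w = CARD('n)})"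
  using face_of_hypercube_cases cube_face_face_of unfolding face_lattice_def by auto

end

theorem theorem6:
  shows "has_rhombic_strip (face_lattice (hypercube :: (real ^ 'n) set)) aff_dim"
proof -
  obtain h :: "'n \<Rightarrow> nat" where h: "bij_betw h UNIV {0..<CARD('n)}"
    using ex_bij_betw_finite_nat[OF finite_class.finite_UNIV] by blast
  show ?thesis
  proof (rule has_rhombic_strip_words[of "CARD('n)" _ "{}" "cube_face h"])
    show "face_lattice (hypercube :: (real ^ 'n) set) = insert {} (cube_face h ` {w. length w = CARD('n)})"
      by (rule face_lattice_hypercube[OF h])
    show "inj_on (cube_face h) {w. length w = CARD('n)}" by (rule inj_on_cube_face[OF h])
    fix u w :: word assume w: "length w = CARD('n)"
    show "{} < cube_face h w" using cube_face_ne[OF h, of w] by auto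
    show "aff_dim (cube_face h w) = int (stars w)" by (rule aff_dim_cube_face[OF h w])
    assume u: "length u = CARD('n)" "word_le u w" "stars u < stars w"
    then have "cube_face h u \<noteq> cube_face h w"
      using aff_dim_cube_face[OF h] w by (metis less_irrefl of_nat_eq_iff)
    then show "cube_face h u < cube_face h w" using cube_face_mono[OF h u(1,2)] by auto
  qed auto
qed

end
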